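(* There is a locally countable Borel partial order of height three with no Borel embedding into Turing reducibility.
   Context: A Borel partial order is a partial order $(P,\leq_P)$ with $P$ a Borel subset of $2^\omega$ and $\leq_P$ a Borel subset of $2^\omega\times 2^\omega$. It is locally countable if every element has at most countably many strict predecessors, and has height $n$ if its longest chain has length exactly $n$. A Borel embedding of $P$ into Turing reducibility is a Borel measurable function $f\colon P\to 2^\omega$ such that for all $x,y\in P$, $x\leq_P y \iff f(x)\leq_T f(y)$. *)

theory Defs
  imports "HOL-Analysis.Analysis"
begin

text \<open>Elements of 2^omega are functions nat => bool. The Borel sigma-algebra of the
product (Cantor) topology is generated by the subbasic clopen cylinders {x. x n}.\<close>

definition cantor :: "(nat \<Rightarrow> bool) measure" where
  "cantor = sigma UNIV {{x. x n} | n. True}"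

text \<open>Borel subsets of 2^omega x 2^omega: since 2^omega is second countable, these are
exactly the sets of the product sigma-algebra.\<close>

abbreviation cantor2 :: "((nat \<Rightarrow> bool) \<times> (nat \<Rightarrow> bool)) measure" where
  "cantor2 \<equiv> cantor \<Otimes>\<^sub>M cantor"

datatype rf =
    Zero
  | Succ
  | Proj nat
  | Oracle
  | Comp rf "rf list"
  | PrimRec rf rf
  | Mu rf

inductive eval :: "(nat \<Rightarrow> bool) \<Rightarrow> rf \<Rightarrow> nat list \<Rightarrow> nat \<Rightarrow> bool" for A where
  eval_Zero: "eval A Zero xs 0"
| eval_Succ: "eval A Succ (x # xs) (Suc x)"
| eval_Proj: "i < length xs \<Longrightarrow> eval A (Proj i) xs (xs ! i)"
| eval_Oracle: "eval A Oracle (x # xs) (if A x then 1 else 0)"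
| eval_Comp: "list_all2 (\<lambda>g v. eval A g xs v) gs vs \<Longrightarrow> eval A f vs v \<Longrightarrow> eval A (Comp f gs) xs v"
| eval_PrimRec0: "eval A f xs v \<Longrightarrow> eval A (PrimRec f g) (0 # xs) v"
| eval_PrimRecS: "eval A (PrimRec f g) (n # xs) r \<Longrightarrow> eval A g (n # r # xs) v
                  \<Longrightarrow> eval A (PrimRec f g) (Suc n # xs) v"
| eval_Mu: "eval A f (n # xs) 0 \<Longrightarrow> (\<forall>m<n. \<exists>v. eval A f (m # xs) v \<and> v \<noteq> 0)
            \<Longrightarrow> eval A (Mu f) xs n"

definition turing_le :: "(nat \<Rightarrow> bool) \<Rightarrow> (nat \<Rightarrow> bool) \<Rightarrow> bool" where
  "turing_le x y \<longleftrightarrow> (\<exists>p. \<forall>n. eval y p [n] (if x n then 1 else 0))"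

definition is_chain_in :: "'a set \<Rightarrow> 'a rel \<Rightarrow> 'a set \<Rightarrow> bool" where
  "is_chain_in P r C \<longleftrightarrow> C \<subseteq> P \<and> (\<forall>x\<in>C. \<forall>y\<in>C. (x, y) \<in> r \<or> (y, x) \<in> r)"

definition has_height :: "'a set \<Rightarrow> 'a rel \<Rightarrow> nat \<Rightarrow> bool" where
  "has_height P r n \<longleftrightarrow>
     (\<exists>C. is_chain_in P r C \<and> finite C \<and> card C = n) \<and>
     (\<forall>C. is_chain_in P r C \<longrightarrow> finite C \<and> card C \<le> n)"

definition locally_countable :: "'a set \<Rightarrow> 'a rel \<Rightarrow> bool" where
  "locally_countable P r \<longleftrightarrow> (\<forall>y\<in>P. countable {x \<in> P. (x, y) \<in> r \<and> x \<noteq> y})"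

definition borel_partial_order :: "(nat \<Rightarrow> bool) set \<Rightarrow> (nat \<Rightarrow> bool) rel \<Rightarrow> bool" where
  "borel_partial_order P r \<longleftrightarrow>
     P \<in> sets cantor \<and> r \<in> sets cantor2 \<and> r \<subseteq> P \<times> P \<and> partial_order_on P r"

definition borel_turing_embedding :: "(nat \<Rightarrow> bool) set \<Rightarrow> (nat \<Rightarrow> bool) rel \<Rightarrow> ((nat \<Rightarrow> bool) \<Rightarrow> (nat \<Rightarrow> bool)) \<Rightarrow> bool" where
  "borel_turing_embedding P r f \<longleftrightarrow>
     f \<in> restrict_space cantor P \<rightarrow>\<^sub>M cantor \<and>
     (\<forall>x\<in>P. \<forall>y\<in>P. (x, y) \<in> r \<longleftrightarrow> turing_le (f x) (f y))"

end

theory Submission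
  imports Defs "HOL-Library.Nat_Bijection"
begin

text \<open>
  Points of level 0 are arbitrary reals, points of level 1 lie above countably many points of level 0,
  and points of level 2 lie above countably many points of levels 0 and 1. An embedding \<open>f\<close> is
  injective on level 0, so it maps some uncountable set of points of level 0 continuously onto a
  closed set \<open>S\<close> of reals. Take disjoint countable subsets \<open>B False\<close> and \<open>B True\<close>, both dense in the
  perfect kernel of \<open>S\<close>, and let \<open>c i\<close> be the image of a point of level 1 lying above exactly
  the preimage of \<open>B i\<close>. Then \<open>c i\<close> computes every element of \<open>B i\<close>, though not uniformly, and no element
  of the other set.

  For every real \<open>x\<close> there are three elements of \<open>S\<close> that together with \<open>c False\<close> and \<open>c True\<close>
  compute \<open>x\<close>. They are limits that switch in turn from one element of the dense sets to another; bit
  \<open>j\<close> of \<open>x\<close> is coded by which of the two sets the \<open>j\<close>-th new element comes from. The positions of the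
  other two limits' switches bound the search for an index of the new element, which makes up for
  the missing uniformity. Applied to the image \<open>x\<close> of a point of level 0 outside all sets involved, this
  gives a point of level 2 whose image computes \<open>x\<close> although it does not lie above that point.
\<close>

section \<open>Functions computable relative to an oracle\<close>

text \<open>The list \<open>vs\<close> holds the variables, as functions of an environment of arbitrary type.
  Environments avoid the de Bruijn bookkeeping of argument lists: a binder just pairs the
  environment with a new value.\<close>

definition comp_in :: "(nat \<Rightarrow> bool) \<Rightarrow> ('e \<Rightarrow> nat) list \<Rightarrow> ('e \<Rightarrow> nat) \<Rightarrow> bool" where
  "comp_in A vs F \<longleftrightarrow> (\<exists>p. \<forall>e. eval A p (map (\<lambda>v. v e) vs) (F e))"

definition dec_in :: "(nat \<Rightarrow> bool) \<Rightarrow> ('e \<Rightarrow> nat) list \<Rightarrow> ('e \<Rightarrow> bool) \<Rightarrow> bool" where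
  "dec_in A vs P \<longleftrightarrow> comp_in A vs (\<lambda>e. if P e then 1 else 0)"

lemma turing_le_iff_dec_in: "turing_le x A \<longleftrightarrow> dec_in A [\<lambda>n. n] x"
  by (simp add: turing_le_def dec_in_def comp_in_def)

lemma turing_le_refl: "turing_le A A"
  unfolding turing_le_def using eval_Oracle[of A _ "[]"] by blast

lemma comp_in_var: "v \<in> set vs \<Longrightarrow> comp_in A vs v"
proof -
  assume "v \<in> set vs"
  then obtain i where i: "i < length vs" "vs ! i = v" by (auto simp: in_set_conv_nth)
  have "eval A (Proj i) (map (\<lambda>v. v e) vs) (v e)" for e
    using eval_Proj[of i "map (\<lambda>v. v e) vs" A] i by simp
  then show ?thesis unfolding comp_in_def by blast
qed

text \<open>Besides realising composition by \<open>Comp\<close>, the map \<open>h\<close> changes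
  the environment: a closure property is proved once for variables in a fixed tuple or list and then
  carried over to arbitrary terms.\<close>

lemma comp_in_subst:
  assumes "comp_in A ws G" and "list_all (\<lambda>w. comp_in A vs (\<lambda>e. w (h e))) ws"
  shows "comp_in A vs (\<lambda>e. G (h e))"
proof -
  obtain p where p: "\<And>e. eval A p (map (\<lambda>v. v e) ws) (G e)"
    using assms(1) unfolding comp_in_def by blast
  obtain q where q: "\<And>w e. w \<in> set ws \<Longrightarrow> eval A (q w) (map (\<lambda>v. v e) vs) (w (h e))"
    using assms(2) unfolding comp_in_def list_all_iff by metis
  have "eval A (Comp p (map q ws)) (map (\<lambda>v. v e) vs) (G (h e))" for e
  proof (rule eval_Comp[OF _ p])
    show "list_all2 (\<lambda>g. eval A g (map (\<lambda>v. v e) vs)) (map q ws) (map (\<lambda>v. v (h e)) ws)"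
      using q by (simp add: list_all2_map1 list_all2_map2 list_all2_same)
  qed
  then show ?thesis unfolding comp_in_def by blast
qed

lemma dec_in_subst:
  assumes "dec_in A ws P" and "list_all (\<lambda>w. comp_in A vs (\<lambda>e. w (h e))) ws"
  shows "dec_in A vs (\<lambda>e. P (h e))"
  using comp_in_subst[OF assms(1)[unfolded dec_in_def] assms(2)] by (simp add: dec_in_def)

section \<open>Closure properties of relative computability\<close>

lemma comp_in_zero: "comp_in A vs (\<lambda>e. 0)"
  unfolding comp_in_def using eval_Zero by blast

lemma comp_in_Suc: "comp_in A vs F \<Longrightarrow> comp_in A vs (\<lambda>e. Suc (F e))"
proof -
  have "comp_in A [\<lambda>n. n] Suc" unfolding comp_in_def using eval_Succ by fastforce
  then show "comp_in A vs F \<Longrightarrow> ?thesis" by (rule comp_in_subst) simp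
qed

lemma comp_in_const: "comp_in A vs (\<lambda>e. n)"
  by (induction n) (simp_all add: comp_in_zero comp_in_Suc)

text \<open>The step function is judged in the environment \<open>(n, r, e)\<close>, whose first two
  components match the arguments that \<open>eval_PrimRecS\<close> puts in front of the old
  ones.\<close>

lemma comp_in_rec:
  assumes N: "comp_in A vs N" and Z: "comp_in A vs Z"
    and S: "comp_in A (fst # (\<lambda>p. fst (snd p)) # map (\<lambda>v p. v (snd (snd p))) vs)
              (\<lambda>p. S (fst p) (fst (snd p)) (snd (snd p)))"
  shows "comp_in A vs (\<lambda>e. rec_nat (Z e) (\<lambda>n r. S n r e) (N e))"
proof -
  obtain pz where pz: "\<And>e. eval A pz (map (\<lambda>v. v e) vs) (Z e)"
    using Z unfolding comp_in_def by blast
  obtain ps where "\<And>x. eval A ps (map (\<lambda>v. v x) (fst # (\<lambda>p. fst (snd p)) # map (\<lambda>v p. v (snd (snd p))) vs))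
      (S (fst x) (fst (snd x)) (snd (snd x)))"
    using S unfolding comp_in_def by blast
  from this[of "(n, r, e)" for n r e]
  have ps: "eval A ps (n # r # map (\<lambda>v. v e) vs) (S n r e)" for n r e
    by (simp add: comp_def)
  have "eval A (PrimRec pz ps) (k # map (\<lambda>v. v e) vs) (rec_nat (Z e) (\<lambda>n r. S n r e) k)" for k e
    by (induction k) (auto intro: eval_PrimRec0 eval_PrimRecS pz ps)
  then have "comp_in A (fst # map (\<lambda>v p. v (snd p)) vs)
      (\<lambda>p. rec_nat (Z (snd p)) (\<lambda>n r. S n r (snd p)) (fst p))"
    unfolding comp_in_def by (auto simp: comp_def)
  from comp_in_subst[OF this, where h = "\<lambda>e. (N e, e)" and vs = vs]
  show ?thesis using N by (auto simp: list_all_iff intro: comp_in_var)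
qed

text \<open>\<open>Mu\<close> stops at the first value 0, so the program handed to it decides the
  negation of \<open>P\<close>.\<close>

lemma comp_in_Least:
  assumes P: "dec_in A (fst # map (\<lambda>v p. v (snd p)) vs) (\<lambda>p. \<not> P (fst p) (snd p))"
    and ex: "\<And>e. \<exists>n. P n e"
  shows "comp_in A vs (\<lambda>e. LEAST n. P n e)"
proof -
  obtain p where "\<And>x. eval A p (map (\<lambda>v. v x) (fst # map (\<lambda>v p. v (snd p)) vs))
      (if \<not> P (fst x) (snd x) then 1 else 0)"
    using P unfolding dec_in_def comp_in_def by blast
  from this[of "(n, e)" for n e]
  have p: "eval A p (n # map (\<lambda>v. v e) vs) (if \<not> P n e then 1 else 0)" for n e
    by (simp add: comp_def)
  have "eval A (Mu p) (map (\<lambda>v. v e) vs) (LEAST n. P n e)" for e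
  proof (rule eval_Mu)
    show "eval A p ((LEAST n. P n e) # map (\<lambda>v. v e) vs) 0"
      using p[of "LEAST n. P n e" e] LeastI_ex[OF ex[of e]] by simp
    show "\<forall>m<LEAST n. P n e. \<exists>v. eval A p (m # map (\<lambda>v. v e) vs) v \<and> v \<noteq> 0"
    proof (intro allI impI)
      fix m assume "m < (LEAST n. P n e)"
      then have "\<not> P m e" by (rule not_less_Least)
      then show "\<exists>v. eval A p (m # map (\<lambda>v. v e) vs) v \<and> v \<noteq> 0"
        using p[of m e] by (intro exI[of _ 1]) simp
    qed
  qed
  then show ?thesis unfolding comp_in_def by blast
qed

lemma comp_in_if:
  assumes "dec_in A vs P" "comp_in A vs F" "comp_in A vs G"
  shows "comp_in A vs (\<lambda>e. if P e then F e else G e)"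
proof -
  have "comp_in A [fst, \<lambda>p. fst (snd p), \<lambda>p. snd (snd p)]
     (\<lambda>p. rec_nat (snd (snd p)) (\<lambda>n r. fst (snd p)) (fst p))"
    by (rule comp_in_rec) (simp_all add: comp_in_var)
  from comp_in_subst[OF this, where h = "\<lambda>e. (if P e then 1 else 0, F e, G e)" and vs = vs] assms
  have "comp_in A vs (\<lambda>e. rec_nat (G e) (\<lambda>n r. F e) (if P e then 1 else 0))"
    by (auto simp: dec_in_def)
  then show ?thesis by (rule back_subst[where P = "comp_in A vs"]) (auto simp: fun_eq_iff)
qed

lemma dec_in_const: "dec_in A vs (\<lambda>e. b)"
  unfolding dec_in_def by (rule comp_in_const)

lemma dec_in_not: "dec_in A vs P \<Longrightarrow> dec_in A vs (\<lambda>e. \<not> P e)"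
proof -
  assume "dec_in A vs P"
  then have "comp_in A vs (\<lambda>e. if P e then 0 else 1)" by (intro comp_in_if comp_in_const)
  then show ?thesis unfolding dec_in_def
    by (rule back_subst[where P = "comp_in A vs"]) (auto simp: fun_eq_iff)
qed

lemma dec_in_conj:
  assumes "dec_in A vs P" "dec_in A vs Q"
  shows "dec_in A vs (\<lambda>e. P e \<and> Q e)"
proof -
  have "comp_in A vs (\<lambda>e. if P e then (if Q e then 1 else 0) else 0)"
    using assms by (intro comp_in_if comp_in_const)
  then show ?thesis unfolding dec_in_def
    by (rule back_subst[where P = "comp_in A vs"]) (auto simp: fun_eq_iff)
qed

lemma dec_in_disj:
  assumes "dec_in A vs P" "dec_in A vs Q"
  shows "dec_in A vs (\<lambda>e. P e \<or> Q e)"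
proof -
  have "comp_in A vs (\<lambda>e. if P e then 1 else (if Q e then 1 else 0))"
    using assms by (intro comp_in_if comp_in_const)
  then show ?thesis unfolding dec_in_def
    by (rule back_subst[where P = "comp_in A vs"]) (auto simp: fun_eq_iff)
qed

lemma dec_in_bex:
  assumes N: "comp_in A vs N"
    and P: "dec_in A (fst # map (\<lambda>v p. v (snd p)) vs) (\<lambda>p. P (fst p) (snd p))"
  shows "dec_in A vs (\<lambda>e. \<exists>i<N e. P i e)"
proof -
  have "dec_in A (fst # (\<lambda>p. fst (snd p)) # map (\<lambda>v p. v (snd (snd p))) vs)
      (\<lambda>p. P (fst p) (snd (snd p)))"
    using dec_in_subst[OF P, where h = "\<lambda>p. (fst p, snd (snd p))" and
        vs = "fst # (\<lambda>p. fst (snd p)) # map (\<lambda>v p. v (snd (snd p))) vs"]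
    by (force simp: list_all_iff intro!: comp_in_var)
  then have "comp_in A vs (\<lambda>e. rec_nat 0 (\<lambda>n r. if P n e then 1 else r) (N e))"
    by (intro comp_in_rec comp_in_if N comp_in_const) (simp_all add: comp_in_var)
  moreover have "rec_nat 0 (\<lambda>n r. if P n e then 1 else r) k = (if \<exists>i<k. P i e then 1 else (0::nat))" for k e
    by (induction k) (auto simp: less_Suc_eq)
  ultimately show ?thesis by (simp add: dec_in_def)
qed

lemma dec_in_ball:
  assumes N: "comp_in A vs N"
    and P: "dec_in A (fst # map (\<lambda>v p. v (snd p)) vs) (\<lambda>p. P (fst p) (snd p))"
  shows "dec_in A vs (\<lambda>e. \<forall>i<N e. P i e)"
proof -
  have "dec_in A vs (\<lambda>e. \<not> (\<exists>i<N e. \<not> P i e))"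
    using assms by (intro dec_in_not dec_in_bex)
  then show ?thesis by simp
qed

lemma comp_in_add:
  assumes "comp_in A vs F" "comp_in A vs G"
  shows "comp_in A vs (\<lambda>e. F e + G e)"
proof -
  have "comp_in A [fst, snd] (\<lambda>p. rec_nat (snd p) (\<lambda>n r. Suc r) (fst p))"
    by (rule comp_in_rec) (simp_all add: comp_in_var comp_in_Suc)
  from comp_in_subst[OF this, where h = "\<lambda>e. (F e, G e)" and vs = vs] assms
  have "comp_in A vs (\<lambda>e. rec_nat (G e) (\<lambda>n r. Suc r) (F e))" by auto
  moreover have "rec_nat m (\<lambda>n r. Suc r) k = k + m" for m k by (induction k) auto
  ultimately show ?thesis by simp
qed

lemma comp_in_pred:
  assumes "comp_in A vs F" shows "comp_in A vs (\<lambda>e. F e - 1)"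
proof -
  have "comp_in A [\<lambda>n. n] (\<lambda>k. rec_nat 0 (\<lambda>n r. n) k)"
    by (rule comp_in_rec) (simp_all add: comp_in_var comp_in_const)
  from comp_in_subst[OF this, where h = F and vs = vs] assms
  have "comp_in A vs (\<lambda>e. rec_nat 0 (\<lambda>n r. n) (F e))" by auto
  moreover have "rec_nat 0 (\<lambda>n r. n) k = k - 1" for k by (cases k) auto
  ultimately show ?thesis by simp
qed

lemma comp_in_diff:
  assumes "comp_in A vs F" "comp_in A vs G"
  shows "comp_in A vs (\<lambda>e. F e - G e)"
proof -
  have "comp_in A [fst, snd] (\<lambda>p. rec_nat (fst p) (\<lambda>n r. r - 1) (snd p))"
    by (intro comp_in_rec comp_in_pred) (simp_all add: comp_in_var)
  from comp_in_subst[OF this, where h = "\<lambda>e. (F e, G e)" and vs = vs] assms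
  have "comp_in A vs (\<lambda>e. rec_nat (F e) (\<lambda>n r. r - 1) (G e))" by auto
  moreover have "rec_nat m (\<lambda>n r. r - 1) k = m - k" for m k :: nat by (induction k) auto
  ultimately show ?thesis by simp
qed

lemma dec_in_eq_zero:
  assumes "comp_in A vs F" shows "dec_in A vs (\<lambda>e. F e = 0)"
proof -
  have "comp_in A [\<lambda>n. n] (\<lambda>k. rec_nat 1 (\<lambda>n r. 0) k)"
    by (rule comp_in_rec) (simp_all add: comp_in_var comp_in_const comp_in_zero)
  from comp_in_subst[OF this, where h = F and vs = vs] assms
  have "comp_in A vs (\<lambda>e. rec_nat 1 (\<lambda>n r. 0) (F e))" by auto
  moreover have "rec_nat 1 (\<lambda>n r. 0) k = (if k = 0 then 1 else 0 :: nat)" for k by (cases k) auto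
  ultimately show ?thesis by (simp add: dec_in_def)
qed

lemma dec_in_le:
  assumes "comp_in A vs F" "comp_in A vs G"
  shows "dec_in A vs (\<lambda>e. F e \<le> G e)"
  using dec_in_eq_zero[OF comp_in_diff[OF assms]] by simp

lemma dec_in_eq:
  assumes "comp_in A vs F" "comp_in A vs G"
  shows "dec_in A vs (\<lambda>e. F e = G e)"
proof -
  have "dec_in A vs (\<lambda>e. F e \<le> G e \<and> G e \<le> F e)"
    using assms by (intro dec_in_conj dec_in_le)
  then show ?thesis by (simp add: eq_iff)
qed

lemma dec_in_oracle:
  assumes "turing_le c A" "comp_in A vs F"
  shows "dec_in A vs (\<lambda>e. c (F e))"
  using assms(1) unfolding turing_le_iff_dec_in
  by (rule dec_in_subst) (simp add: assms(2))

lemmas basic_rules = comp_in_const comp_in_Suc comp_in_if comp_in_add dec_in_const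
  dec_in_not dec_in_conj dec_in_disj dec_in_bex dec_in_ball dec_in_le dec_in_eq

text \<open>Unbounded search: \<open>G\<close> recognises the acceptable \<open>s\<close> for input
  \<open>k\<close>, and every acceptable \<open>s\<close> determines the bit through
  \<open>Q\<close>.\<close>

lemma turing_leI_search:
  assumes G: "dec_in A [fst, snd] (\<lambda>p. G (fst p) (snd p))"
    and Q: "dec_in A [fst, snd] (\<lambda>p. Q (fst p) (snd p))"
    and ex: "\<And>k. \<exists>s. G k s"
    and sound: "\<And>k s. G k s \<Longrightarrow> Q k s \<longleftrightarrow> x k"
  shows "turing_le x A"
proof -
  have "dec_in A [fst, snd] (\<lambda>p. \<not> G (snd p) (fst p))"
    using dec_in_subst[OF dec_in_not[OF G], where h = "\<lambda>p. (snd p, fst p)" and vs = "[fst, snd]"]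
    by (auto simp: comp_in_var)
  then have L: "comp_in A [\<lambda>k. k] (\<lambda>k. LEAST s. G k s)"
    using ex by (intro comp_in_Least) simp_all
  have "dec_in A [\<lambda>k. k] (\<lambda>k. Q k (LEAST s. G k s))"
    using dec_in_subst[OF Q, where h = "\<lambda>k. (k, LEAST s. G k s)" and vs = "[\<lambda>k. k]"] L
    by (auto simp: comp_in_var)
  moreover have "Q k (LEAST s. G k s) = x k" for k
    using sound LeastI_ex[OF ex] by blast
  ultimately show ?thesis by (simp add: turing_le_iff_dec_in)
qed

section \<open>Coding of pairs and sequences\<close>

definition pair :: "nat \<Rightarrow> nat \<Rightarrow> nat" where "pair a b = prod_encode (a, b)"
definition pfst :: "nat \<Rightarrow> nat" where "pfst z = fst (prod_decode z)"
definition psnd :: "nat \<Rightarrow> nat" where "psnd z = snd (prod_decode z)"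
text \<open>Every number decodes as a pair, so \<open>entry\<close> is total and returns a value
  past the end of a sequence as well; \<open>seq_code\<close> stores no length.\<close>

definition entry :: "nat \<Rightarrow> nat \<Rightarrow> nat" where
  "entry s i = pfst (rec_nat s (\<lambda>_. psnd) i)"
definition seq_code :: "nat list \<Rightarrow> nat" where
  "seq_code xs = foldr pair xs 0"

lemma pair_simps [simp]: "pfst (pair a b) = a" "psnd (pair a b) = b"
  "pair a b = pair a' b' \<longleftrightarrow> a = a' \<and> b = b'"
  by (simp_all add: pair_def pfst_def psnd_def)

lemma pair_collapse [simp]: "pair (pfst z) (psnd z) = z"
  by (simp add: pair_def pfst_def psnd_def)

lemma psnd_le: "psnd z \<le> z"
  using le_prod_encode_2[of "psnd z" "pfst z"] by (simp flip: pair_def)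

lemma rec_nat_psnd_Suc: "rec_nat (pair a b) (\<lambda>_. psnd) (Suc i) = rec_nat b (\<lambda>_. psnd) i"
  by (induction i) auto

lemma entry_seq_code: "i < length xs \<Longrightarrow> entry (seq_code xs) i = xs ! i"
proof (induction xs arbitrary: i)
  case (Cons x xs)
  show ?case
  proof (cases i)
    case 0
    then show ?thesis by (simp add: entry_def seq_code_def)
  next
    case (Suc j)
    have "entry (seq_code (x # xs)) (Suc j) = entry (seq_code xs) j"
      unfolding entry_def seq_code_def foldr.simps comp_def rec_nat_psnd_Suc ..
    then show ?thesis using Suc Cons by simp
  qed
qed simp

lemma comp_in_pair:
  assumes "comp_in A vs F" "comp_in A vs G"
  shows "comp_in A vs (\<lambda>e. pair (F e) (G e))"
proof -
  have tri: "rec_nat 0 (\<lambda>n r. Suc (n + r)) k = triangle k" for k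
    by (induction k) (auto)
  have "comp_in A [fst, snd] (\<lambda>p. rec_nat 0 (\<lambda>n r. Suc (n + r)) (fst p + snd p) + fst p)"
    by (intro comp_in_rec basic_rules) (simp_all add: comp_in_var)
  from comp_in_subst[OF this, where h = "\<lambda>e. (F e, G e)" and vs = vs] assms
  show ?thesis by (auto simp: tri pair_def prod_encode_def)
qed

text \<open>The first component is found by unbounded search. Its partner is at most
  \<open>z\<close> by \<open>psnd_le\<close>, which makes the test decidable.\<close>

lemma comp_in_pfst:
  assumes "comp_in A vs F" shows "comp_in A vs (\<lambda>e. pfst (F e))"
proof -
  have eq: "(LEAST a. \<exists>b<Suc z. pair a b = z) = pfst z" for z
  proof (rule Least_equality)
    show "\<exists>b<Suc z. pair (pfst z) b = z"
      by (intro exI[of _ "psnd z"]) (simp add: psnd_le le_imp_less_Suc)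
  qed auto
  have "comp_in A [\<lambda>z. z] (\<lambda>z. LEAST a. \<exists>b<Suc z. pair a b = z)"
  proof (rule comp_in_Least)
    show "\<exists>a. \<exists>b<Suc z. pair a b = z" for z
      by (intro exI[of _ "pfst z"] exI[of _ "psnd z"]) (simp add: psnd_le le_imp_less_Suc)
  qed (intro basic_rules comp_in_pair; simp add: comp_in_var)
  from comp_in_subst[OF this, where h = F and vs = vs] assms
  show ?thesis by (simp add: eq)
qed

lemma comp_in_psnd:
  assumes "comp_in A vs F" shows "comp_in A vs (\<lambda>e. psnd (F e))"
proof -
  have eq: "(LEAST b. pair (pfst z) b = z) = psnd z" for z
    by (rule Least_equality) (auto dest: arg_cong[where f = psnd])
  have "comp_in A [\<lambda>z. z] (\<lambda>z. LEAST b. pair (pfst z) b = z)"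
  proof (rule comp_in_Least)
    show "\<exists>b. pair (pfst z) b = z" for z by (rule exI[of _ "psnd z"]) simp
  qed (intro basic_rules comp_in_pair comp_in_pfst; simp add: comp_in_var)
  from comp_in_subst[OF this, where h = F and vs = vs] assms
  show ?thesis by (simp add: eq)
qed

lemma comp_in_entry:
  assumes "comp_in A vs F" "comp_in A vs G" shows "comp_in A vs (\<lambda>e. entry (F e) (G e))"
proof -
  have "comp_in A [fst, snd] (\<lambda>p. entry (fst p) (snd p))"
    unfolding entry_def
    by (intro comp_in_rec comp_in_pfst comp_in_psnd) (simp_all add: comp_in_var)
  from comp_in_subst[OF this, where h = "\<lambda>e. (F e, G e)" and vs = vs] assms
  show ?thesis by auto
qed

lemmas comp_rules = basic_rules comp_in_pair comp_in_pfst comp_in_psnd comp_in_entry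

section \<open>A universal relation\<close>

text \<open>Programs are numbers \<open>triple tag a b\<close>. The tags 7 and 8 stand for the empty and the
  nonempty list of programs, which evaluate to the coded list of their values; this turns the
  nested recursion in composition into ordinary evaluation.\<close>

definition triple :: "nat \<Rightarrow> nat \<Rightarrow> nat \<Rightarrow> nat" where "triple a b c = pair a (pair b c)"

primrec prog_code :: "rf \<Rightarrow> nat" where
  "prog_code Zero = triple 0 0 0"
| "prog_code Succ = triple 1 0 0"
| "prog_code (Proj i) = triple 2 i 0"
| "prog_code Oracle = triple 3 0 0"
| "prog_code (Comp f gs) = triple 4 (prog_code f) (foldr (triple 8) (map prog_code gs) (triple 7 0 0))"
| "prog_code (PrimRec f g) = triple 5 (prog_code f) (prog_code g)"
| "prog_code (Mu f) = triple 6 (prog_code f) 0"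

text \<open>One step of a derivation of ``program \<open>e\<close> maps the coded list \<open>X\<close> to \<open>v\<close>'' from the
  judgements in \<open>S\<close>. The bound \<open>B\<close> on the quantifiers makes it decidable.\<close>

definition derives ::
    "(nat \<Rightarrow> bool) \<Rightarrow> nat \<Rightarrow> (nat \<Rightarrow> nat \<Rightarrow> nat \<Rightarrow> bool) \<Rightarrow> nat \<Rightarrow> nat \<Rightarrow> nat \<Rightarrow> nat \<Rightarrow> nat \<Rightarrow> bool" where
  "derives A B S t a b X v \<longleftrightarrow>
     (t = 0 \<and> v = 0) \<or>
     (t = 1 \<and> v = Suc (pfst X)) \<or>
     (t = 2 \<and> v = entry X a) \<or>
     (t = 3 \<and> v = (if A (pfst X) then 1 else 0)) \<or>
     (t = 4 \<and> (\<exists>V<B. S b X V \<and> S a V v)) \<or>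
     (t = 5 \<and> pfst X = 0 \<and> S a (psnd X) v) \<or>
     (t = 5 \<and> (\<exists>n<B. \<exists>r<B. pfst X = Suc n \<and> S (triple t a b) (pair n (psnd X)) r \<and>
                           S b (pair n (pair r (psnd X))) v)) \<or>
     (t = 6 \<and> S a (pair v X) 0 \<and> (\<forall>m<v. \<exists>w<B. w \<noteq> 0 \<and> S a (pair m X) w)) \<or>
     (t = 7 \<and> v = 0) \<or>
     (t = 8 \<and> (\<exists>x<B. \<exists>y<B. S a X x \<and> S b X y \<and> v = pair x y))"

definition earlier :: "nat list \<Rightarrow> nat \<Rightarrow> nat \<Rightarrow> nat \<Rightarrow> nat \<Rightarrow> bool" where
  "earlier es i e X v \<longleftrightarrow> (\<exists>j<i. es ! j = triple e X v)"

definition derivation :: "(nat \<Rightarrow> bool) \<Rightarrow> nat \<Rightarrow> nat list \<Rightarrow> bool" where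
  "derivation A B es \<longleftrightarrow> (\<forall>i<length es. \<exists>t a b X v. es ! i = triple (triple t a b) X v \<and>
     derives A B (earlier es i) t a b X v)"

text \<open>A finite derivation has a numerical witness that can be searched for. As
  \<open>B\<close> is existential, bounding the quantifiers loses nothing.\<close>

definition univ_rel :: "(nat \<Rightarrow> bool) \<Rightarrow> nat \<Rightarrow> nat \<Rightarrow> nat \<Rightarrow> bool" where
  "univ_rel A e X v \<longleftrightarrow> (\<exists>B es. derivation A B es \<and> triple e X v \<in> set es)"

lemma triple_inject [simp]: "triple a b c = triple a' b' c' \<longleftrightarrow> a = a' \<and> b = b' \<and> c = c'"
  by (simp add: triple_def)

lemma triple_cases: obtains a b c where "z = triple a b c"
  using that[of "pfst z" "pfst (psnd z)" "psnd (psnd z)"] by (simp add: triple_def)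

section \<open>Combining finite derivations\<close>

lemma derives_mono:
  assumes "derives A B S t a b X v" "B \<le> B'" "\<And>e X v. S e X v \<Longrightarrow> S' e X v"
  shows "derives A B' S' t a b X v"
proof -
  have ex: "\<exists>i<B'. Q i" if "\<exists>i<B. P i" "\<And>i. P i \<Longrightarrow> Q i" for P Q
    using that assms(2) order_less_le_trans by blast
  show ?thesis
    using assms(1) unfolding derives_def
    by (elim disj_forward conj_forward all_forward imp_forward ex) (simp_all add: assms(3))
qed

lemma derives_simps:
  "derives A B S 0 a b X v \<longleftrightarrow> v = 0"
  "derives A B S (Suc 0) a b X v \<longleftrightarrow> v = Suc (pfst X)"
  "derives A B S 2 a b X v \<longleftrightarrow> v = entry X a"
  "derives A B S 3 a b X v \<longleftrightarrow> v = (if A (pfst X) then 1 else 0)"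
  "derives A B S 4 a b X v \<longleftrightarrow> (\<exists>V<B. S b X V \<and> S a V v)"
  "derives A B S 5 a b X v \<longleftrightarrow> pfst X = 0 \<and> S a (psnd X) v \<or>
     (\<exists>n<B. \<exists>r<B. pfst X = Suc n \<and> S (triple 5 a b) (pair n (psnd X)) r \<and>
                           S b (pair n (pair r (psnd X))) v)"
  "derives A B S 6 a b X v \<longleftrightarrow>
     S a (pair v X) 0 \<and> (\<forall>m<v. \<exists>w<B. w \<noteq> 0 \<and> S a (pair m X) w)"
  "derives A B S 7 a b X v \<longleftrightarrow> v = 0"
  "derives A B S 8 a b X v \<longleftrightarrow> (\<exists>x<B. \<exists>y<B. S a X x \<and> S b X y \<and> v = pair x y)"
  by (simp_all add: derives_def)

lemma derives_rec_Suc: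
  assumes "n < B" "r < B" "pfst X = Suc n" "S (triple 5 a b) (pair n (psnd X)) r"
    "S b (pair n (pair r (psnd X))) v"
  shows "derives A B S 5 a b X v"
  using assms unfolding derives_simps by (intro disjI2 exI[of _ n] exI[of _ r] conjI)

lemma derives_mu:
  assumes "S a (pair v X) 0" "\<And>m. m < v \<Longrightarrow> w m < B \<and> w m \<noteq> 0 \<and> S a (pair m X) (w m)"
  shows "derives A B S 6 a b X v"
  using assms unfolding derives_simps by (intro conjI allI impI exI[of _ "w m" for m]) auto

lemma earlier_append: "i \<le> length es \<Longrightarrow> earlier (es @ es') i = earlier es i"
  unfolding earlier_def fun_eq_iff by (metis nth_append order_less_le_trans)

text \<open>Shifting the second list by \<open>length es\<close> keeps its premises earlier than its
  conclusions, and \<open>derives_mono\<close> absorbs the larger bound.\<close>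

lemma derivation_append:
  assumes "derivation A B es" "derivation A B' es'" "B \<le> C" "B' \<le> C"
  shows "derivation A C (es @ es')"
  unfolding derivation_def
proof (intro allI impI)
  fix i assume i: "i < length (es @ es')"
  show "\<exists>t a b X v. (es @ es') ! i = triple (triple t a b) X v \<and>
     derives A C (earlier (es @ es') i) t a b X v"
  proof (cases "i < length es")
    case True
    then obtain t a b X v where *: "es ! i = triple (triple t a b) X v"
      "derives A B (earlier es i) t a b X v"
      using assms(1) unfolding derivation_def by blast
    have "derives A C (earlier (es @ es') i) t a b X v"
      using *(2) assms(3) by (rule derives_mono) (use True in \<open>simp add: earlier_append\<close>)
    then show ?thesis using * True by (auto simp: nth_append)
  next
    case False
    define k where "k = i - length es"
    have k: "i = length es + k" "k < length es'" using False i by (auto simp: k_def)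
    then obtain t a b X v where *: "es' ! k = triple (triple t a b) X v"
      "derives A B' (earlier es' k) t a b X v"
      using assms(2) unfolding derivation_def by blast
    have "derives A C (earlier (es @ es') i) t a b X v"
      using *(2) assms(4)
    proof (rule derives_mono)
      fix e X v assume "earlier es' k e X v"
      then obtain j where "j < k" "es' ! j = triple e X v" by (auto simp: earlier_def)
      then show "earlier (es @ es') i e X v"
        unfolding earlier_def k by (intro exI[of _ "length es + j"]) simp
    qed
    then show ?thesis using * k by (auto simp: nth_append)
  qed
qed

lemma univ_rel_finite_derivation:
  assumes "finite J" "\<And>e X v. (e, X, v) \<in> J \<Longrightarrow> univ_rel A e X v"
  shows "\<exists>B es. derivation A B es \<and> (\<forall>(e, X, v) \<in> J. triple e X v \<in> set es)"
  using assms
proof (induction J rule: finite_induct)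
  case empty
  have "derivation A 0 []" by (simp add: derivation_def)
  then show ?case by blast
next
  case (insert x J)
  obtain e X v where x: "x = (e, X, v)" by (cases x) auto
  obtain B es where 1: "derivation A B es" "\<forall>(e, X, v) \<in> J. triple e X v \<in> set es"
    using insert by blast
  obtain B' es' where 2: "derivation A B' es'" "triple e X v \<in> set es'"
    using insert.prems[of e X v] x unfolding univ_rel_def by auto
  have "derivation A (max B B') (es @ es')" by (rule derivation_append[OF 1(1) 2(1)]) auto
  then show ?case using 1 2 x by (intro exI[of _ "max B B'"] exI[of _ "es @ es'"]) auto
qed

text \<open>A common derivation of the finitely many premises \<open>J\<close> is extended by the
  conclusion. Each case of \<open>univ_rel_complete\<close> is one such step.\<close>

lemma univ_rel_closed:
  assumes d: "derives A C (\<lambda>e X v. (e, X, v) \<in> J) t a b X v" and "finite J"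
    and "\<And>e X v. (e, X, v) \<in> J \<Longrightarrow> univ_rel A e X v"
  shows "univ_rel A (triple t a b) X v"
proof -
  obtain B es where es: "derivation A B es" "\<forall>(e, X, v) \<in> J. triple e X v \<in> set es"
    using univ_rel_finite_derivation[OF assms(2,3)] by blast
  let ?es = "es @ [triple (triple t a b) X v]"
  have last: "derives A (max B C) (earlier ?es (length es)) t a b X v"
    using d
  proof (rule derives_mono)
    fix e X v assume "(e, X, v) \<in> J"
    then have "triple e X v \<in> set es" using es(2) by auto
    then show "earlier ?es (length es) e X v"
      by (auto simp: earlier_def in_set_conv_nth nth_append)
  qed simp
  have "derivation A (max B C) ?es"
    unfolding derivation_def
  proof (intro allI impI)
    fix i assume i: "i < length ?es"
    show "\<exists>t a b X v. ?es ! i = triple (triple t a b) X v \<and>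
      derives A (max B C) (earlier ?es i) t a b X v"
    proof (cases "i < length es")
      case True
      then obtain t' a' b' X' v' where *: "es ! i = triple (triple t' a' b') X' v'"
        "derives A B (earlier es i) t' a' b' X' v'"
        using es(1) unfolding derivation_def by blast
      have "derives A (max B C) (earlier ?es i) t' a' b' X' v'"
        using *(2) by (rule derives_mono) (use True in \<open>simp_all add: earlier_append\<close>)
      then show ?thesis using * True by (auto simp: nth_append)
    next
      case False
      then have "i = length es" using i by simp
      then show ?thesis using last by auto
    qed
  qed
  then show ?thesis unfolding univ_rel_def by (meson in_set_conv_decomp)
qed

lemma univ_rel_complete:
  assumes "eval A p xs v" shows "univ_rel A (prog_code p) (seq_code xs) v"
  using assms
proof (induction rule: eval.induct)
  case (eval_Zero xs)
  show ?case by (simp, rule univ_rel_closed[where J = "{}" and C = 0]) (auto simp: derives_def)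
next
  case (eval_Succ x xs)
  show ?case by (simp, rule univ_rel_closed[where J = "{}" and C = 0]) (auto simp: derives_def seq_code_def)
next
  case (eval_Proj i xs)
  then show ?case
    by (simp, intro univ_rel_closed[where J = "{}" and C = 0]) (auto simp: derives_def entry_seq_code)
next
  case (eval_Oracle x xs)
  show ?case unfolding prog_code.simps
    by (rule univ_rel_closed[where J = "{}" and C = 0]) (auto simp: derives_def seq_code_def)
next
  case (eval_Comp xs gs vs f v)
  \<comment> \<open>An inner induction along the argument list evaluates the coded list of programs
    (tags 7 and 8) to the coded list of values.\<close>
  have "univ_rel A (foldr (triple 8) (map prog_code gs) (triple 7 0 0)) (seq_code xs) (seq_code vs)"
    using eval_Comp(1)
  proof (induction rule: list_all2_induct)
    case Nil
    show ?case by (simp, rule univ_rel_closed[where J = "{}" and C = 0]) (auto simp: derives_def seq_code_def)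
  next
    case (Cons g gs x vs)
    let ?J = "{(prog_code g, seq_code xs, x),
      (foldr (triple 8) (map prog_code gs) (triple 7 0 0), seq_code xs, seq_code vs)}"
    have "univ_rel A (triple 8 (prog_code g) (foldr (triple 8) (map prog_code gs) (triple 7 0 0)))
        (seq_code xs) (pair x (seq_code vs))"
      by (rule univ_rel_closed[where J = ?J and C = "Suc (max x (seq_code vs))"])
        (use Cons in \<open>auto simp: derives_def\<close>)
    then show ?case by (simp add: seq_code_def)
  qed
  moreover have "univ_rel A (prog_code f) (seq_code vs) v" by (rule eval_Comp)
  ultimately show ?case
    by (simp, intro univ_rel_closed[where C = "Suc (seq_code vs)" and
          J = "{(foldr (triple 8) (map prog_code gs) (triple 7 0 0), seq_code xs, seq_code vs),
                (prog_code f, seq_code vs, v)}"]) (auto simp: derives_def)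
next
  case (eval_PrimRec0 f xs v g)
  then show ?case
    by (simp, intro univ_rel_closed[where C = 0 and J = "{(prog_code f, seq_code xs, v)}"])
      (auto simp: derives_def seq_code_def)
next
  case (eval_PrimRecS f g n xs r v)
  let ?J = "{(triple 5 (prog_code f) (prog_code g), seq_code (n # xs), r),
    (prog_code g, seq_code (n # r # xs), v)}"
  have "derives A (Suc (max n r)) (\<lambda>e X v. (e, X, v) \<in> ?J) 5 (prog_code f) (prog_code g)
      (seq_code (Suc n # xs)) v"
    by (rule derives_rec_Suc[where n = n and r = r]) (simp_all add: seq_code_def)
  then show ?case unfolding prog_code.simps
    by (rule univ_rel_closed) (use eval_PrimRecS.IH in auto)
next
  case (eval_Mu f n xs)
  then obtain w where w: "\<And>m. m < n \<Longrightarrow> univ_rel A (prog_code f) (seq_code (m # xs)) (w m) \<and> w m \<noteq> 0"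
    by metis
  let ?J = "insert (prog_code f, seq_code (n # xs), 0)
    ((\<lambda>m. (prog_code f, seq_code (m # xs), w m)) ` {..<n})"
  \<comment> \<open>One bound has to exceed the witnesses for all \<open>m < n\<close>; the
    successor of their sum does.\<close>
  have bd: "w m < Suc (\<Sum>m<n. w m)" if "m < n" for m
    using member_le_sum[of m "{..<n}" w] that by (simp add: le_imp_less_Suc)
  have "derives A (Suc (\<Sum>m<n. w m)) (\<lambda>e X v. (e, X, v) \<in> ?J) 6 (prog_code f) 0 (seq_code xs) n"
  proof (rule derives_mu)
    show "w m < Suc (\<Sum>m<n. w m) \<and> w m \<noteq> 0 \<and> (prog_code f, pair m (seq_code xs), w m) \<in> ?J"
      if "m < n" for m using w bd that by (simp add: seq_code_def)
  qed (simp add: seq_code_def)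
  then show ?case unfolding prog_code.simps
    by (rule univ_rel_closed) (use w eval_Mu.IH in auto)
qed

text \<open>Premises sit strictly earlier in both lists, so induction on the position in the first
  one makes them agree. The two derivations may have different bounds.\<close>

lemma derivation_deterministic:
  assumes es: "derivation A B es" and es': "derivation A B' es'"
  shows "\<lbrakk>i < length es; es ! i = triple e X v; j < length es'; es' ! j = triple e X v'\<rbrakk> \<Longrightarrow> v = v'"
proof (induction i arbitrary: e X v j v' rule: less_induct)
  case (less i)
  obtain t a b where e: "e = triple t a b" by (rule triple_cases)
  have d: "derives A B (earlier es i) t a b X v"
    using es less.prems e unfolding derivation_def by fastforce
  have d': "derives A B' (earlier es' j) t a b X v'"
    using es' less.prems e unfolding derivation_def by fastforce
  have IH: "w = w'" if "earlier es i f Y w" "earlier es' j f Y w'" for f Y w w'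
    using that less.IH less.prems(1,3) unfolding earlier_def by (meson less_trans)
  consider "t = 0 \<or> t = Suc 0 \<or> t = 2 \<or> t = 3 \<or> t = 7" | "t = 4" | "t = 5" | "t = 6" | "t = 8"
    using d unfolding derives_def One_nat_def by blast
  then show ?case
  proof cases
    case 1
    then show ?thesis using d d' by (elim disjE) (simp_all add: derives_simps)
  next
    case 2
    obtain V where V: "earlier es i b X V" "earlier es i a V v"
      using d unfolding 2 derives_simps by blast
    obtain V' where V': "earlier es' j b X V'" "earlier es' j a V' v'"
      using d' unfolding 2 derives_simps by blast
    show ?thesis using IH[OF V(1) V'(1)] IH[OF V(2)] V'(2) by simp
  next
    case 3
    show ?thesis
    proof (cases "pfst X")
      case 0
      then show ?thesis using d d' IH unfolding 3 derives_simps by auto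
    next
      case (Suc n)
      obtain r where r: "earlier es i (triple t a b) (pair n (psnd X)) r"
          "earlier es i b (pair n (pair r (psnd X))) v"
        using d Suc unfolding 3 derives_simps by auto
      obtain r' where r': "earlier es' j (triple t a b) (pair n (psnd X)) r'"
          "earlier es' j b (pair n (pair r' (psnd X))) v'"
        using d' Suc unfolding 3 derives_simps by auto
      show ?thesis using IH[OF r(1) r'(1)] IH[OF r(2)] r'(2) by simp
    qed
  next
    case 4
    have z: "earlier es i a (pair v X) 0"
      "\<And>m. m < v \<Longrightarrow> \<exists>w. w \<noteq> 0 \<and> earlier es i a (pair m X) w"
      using d unfolding 4 derives_simps by blast+
    have z': "earlier es' j a (pair v' X) 0"
      "\<And>m. m < v' \<Longrightarrow> \<exists>w. w \<noteq> 0 \<and> earlier es' j a (pair m X) w"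
      using d' unfolding 4 derives_simps by blast+
    \<comment> \<open>The smaller of two different minima would have value 0 in one derivation and a
      nonzero value in the other.\<close>
    have False if "v < v'"
      using z'(2)[OF that] IH[OF z(1)] by metis
    moreover have False if "v' < v"
      using z(2)[OF that] IH[OF _ z'(1)] by metis
    ultimately show ?thesis by (meson linorder_neqE_nat)
  next
    case 5
    obtain x y where x: "earlier es i a X x" "earlier es i b X y" "v = pair x y"
      using d unfolding 5 derives_simps by blast
    obtain x' y' where x': "earlier es' j a X x'" "earlier es' j b X y'" "v' = pair x' y'"
      using d' unfolding 5 derives_simps by blast
    show ?thesis using IH[OF x(1) x'(1)] IH[OF x(2) x'(2)] x(3) x'(3) by simp
  qed
qed

lemma univ_rel_deterministic:
  assumes "univ_rel A e X v" "univ_rel A e X v'" shows "v = v'"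
proof -
  obtain B es i B' es' j where "derivation A B es" "derivation A B' es'"
    "i < length es" "es ! i = triple e X v" "j < length es'" "es' ! j = triple e X v'"
    using assms unfolding univ_rel_def in_set_conv_nth by blast
  then show ?thesis by (rule derivation_deterministic)
qed

section \<open>Numerical certificates for the universal relation\<close>

definition code_earlier :: "nat \<Rightarrow> nat \<Rightarrow> nat \<Rightarrow> nat \<Rightarrow> nat \<Rightarrow> bool" where
  "code_earlier w i e X v \<longleftrightarrow> (\<exists>j<i. entry w j = triple e X v)"

definition code_step :: "(nat \<Rightarrow> bool) \<Rightarrow> nat \<Rightarrow> nat \<Rightarrow> nat \<Rightarrow> nat \<Rightarrow> bool" where
  "code_step c B w i z \<longleftrightarrow> derives c B (code_earlier w i) (pfst (pfst z)) (pfst (psnd (pfst z)))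
     (psnd (psnd (pfst z))) (pfst (psnd z)) (psnd (psnd z))"

text \<open>The certificate \<open>s\<close> packs the length of a derivation, its bound and the
  code of its list of judgements, in this order.\<close>

definition certifies :: "(nat \<Rightarrow> bool) \<Rightarrow> nat \<Rightarrow> nat \<Rightarrow> nat \<Rightarrow> nat \<Rightarrow> bool" where
  "certifies c s e X v \<longleftrightarrow> code_earlier (psnd (psnd s)) (pfst s) e X v \<and>
     (\<forall>i<pfst s. code_step c (pfst (psnd s)) (psnd (psnd s)) i (entry (psnd (psnd s)) i))"

lemma univ_rel_iff_certifies: "univ_rel c e X v \<longleftrightarrow> (\<exists>s. certifies c s e X v)"
proof
  assume "univ_rel c e X v"
  then obtain B es where es: "derivation c B es" "triple e X v \<in> set es"
    unfolding univ_rel_def by blast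
  let ?w = "seq_code es"
  have eq: "code_earlier ?w i = earlier es i" if "i \<le> length es" for i
    using that by (intro ext) (auto simp: code_earlier_def earlier_def entry_seq_code)
  have "code_step c B ?w i (entry ?w i)" if i: "i < length es" for i
  proof -
    obtain t a b X v where "es ! i = triple (triple t a b) X v" "derives c B (earlier es i) t a b X v"
      using es(1) i unfolding derivation_def by blast
    then show ?thesis using i eq[of i] by (simp add: code_step_def entry_seq_code triple_def)
  qed
  moreover have "code_earlier ?w (length es) e X v"
    using es(2) eq[of "length es"] by (simp add: earlier_def in_set_conv_nth)
  ultimately have "certifies c (pair (length es) (pair B ?w)) e X v"
    by (simp add: certifies_def)
  then show "\<exists>s. certifies c s e X v" by blast
next
  assume "\<exists>s. certifies c s e X v"
  then obtain s where s: "certifies c s e X v" by blast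
  define k B w where "k = pfst s" and "B = pfst (psnd s)" and "w = psnd (psnd s)"
  let ?es = "map (entry w) [0..<k]"
  have eq: "code_earlier w i = earlier ?es i" if "i \<le> k" for i
    using that by (intro ext) (auto simp: code_earlier_def earlier_def)
  have "derivation c B ?es"
    unfolding derivation_def
  proof (intro allI impI)
    fix i assume i: "i < length ?es"
    obtain f X v where 1: "entry w i = triple f X v" by (rule triple_cases)
    obtain t a b where 2: "f = triple t a b" by (rule triple_cases)
    have "code_step c B w i (entry w i)"
      using s i by (simp add: certifies_def k_def B_def w_def)
    then have "derives c B (earlier ?es i) t a b X v"
      using i eq[of i] by (simp add: 1 2 code_step_def triple_def)
    moreover have "?es ! i = triple (triple t a b) X v" using i 1 2 by simp
    ultimately show "\<exists>t a b X v. ?es ! i = triple (triple t a b) X v \<and> derives c B (earlier ?es i) t a b X v"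
      by blast
  qed
  moreover have "triple e X v \<in> set ?es"
    using s by (force simp: certifies_def code_earlier_def image_iff k_def w_def)
  ultimately show "univ_rel c e X v" unfolding univ_rel_def by blast
qed

lemma comp_in_triple:
  "comp_in A vs F \<Longrightarrow> comp_in A vs G \<Longrightarrow> comp_in A vs H \<Longrightarrow> comp_in A vs (\<lambda>e. triple (F e) (G e) (H e))"
  unfolding triple_def by (intro comp_in_pair)

text \<open>The environment is a list here, so that the closure rules meet only fixed variables;
  substitution then inserts the actual terms.\<close>

lemma dec_in_code_earlier:
  assumes "comp_in A vs W" "comp_in A vs I" "comp_in A vs E" "comp_in A vs X" "comp_in A vs V"
  shows "dec_in A vs (\<lambda>e. code_earlier (W e) (I e) (E e) (X e) (V e))"
proof -
  have "dec_in A [\<lambda>l. l ! 0, \<lambda>l. l ! 1, \<lambda>l. l ! 2, \<lambda>l. l ! 3, \<lambda>l. l ! 4]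
     (\<lambda>l. code_earlier (l ! 0) (l ! 1) (l ! 2) (l ! 3) (l ! 4))"
    unfolding code_earlier_def
    by (intro comp_rules comp_in_triple) (simp_all add: comp_in_var)
  from dec_in_subst[OF this, where h = "\<lambda>e. [W e, I e, E e, X e, V e]" and vs = vs] assms
  show ?thesis by simp
qed

lemma dec_in_code_step:
  assumes c: "turing_le c A"
    and "comp_in A vs B" "comp_in A vs W" "comp_in A vs I" "comp_in A vs Z"
  shows "dec_in A vs (\<lambda>e. code_step c (B e) (W e) (I e) (Z e))"
proof -
  have "dec_in A [\<lambda>l. l ! 0, \<lambda>l. l ! 1, \<lambda>l. l ! 2, \<lambda>l. l ! 3]
     (\<lambda>l. code_step c (l ! 0) (l ! 1) (l ! 2) (l ! 3))"
    unfolding code_step_def derives_def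
    by (intro comp_rules comp_in_triple dec_in_code_earlier dec_in_oracle[OF c])
      (simp_all add: comp_in_var)
  from dec_in_subst[OF this, where h = "\<lambda>e. [B e, W e, I e, Z e]" and vs = vs] assms
  show ?thesis by simp
qed

lemma dec_in_certifies:
  assumes c: "turing_le c A"
    and "comp_in A vs S" "comp_in A vs E" "comp_in A vs X" "comp_in A vs V"
  shows "dec_in A vs (\<lambda>e. certifies c (S e) (E e) (X e) (V e))"
proof -
  have "dec_in A [\<lambda>l. l ! 0, \<lambda>l. l ! 1, \<lambda>l. l ! 2, \<lambda>l. l ! 3]
     (\<lambda>l. certifies c (l ! 0) (l ! 1) (l ! 2) (l ! 3))"
    unfolding certifies_def
    by (intro comp_rules dec_in_code_earlier dec_in_code_step[OF c]) (simp_all add: comp_in_var)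
  from dec_in_subst[OF this, where h = "\<lambda>e. [S e, E e, X e, V e]" and vs = vs] assms
  show ?thesis by simp
qed

section \<open>Coding a real by three limits of computable reals\<close>

text \<open>Departing is witnessed by finitely many values of index \<open>e\<close>, whether or not
  \<open>e\<close> is total, and can therefore be verified by search.\<close>

definition departs :: "(nat \<Rightarrow> nat \<Rightarrow> bool \<Rightarrow> bool) \<Rightarrow> nat \<Rightarrow> (nat \<Rightarrow> bool) \<Rightarrow> nat \<Rightarrow> bool" where
  "departs \<Psi> e z d \<longleftrightarrow> (\<forall>i<d. \<Psi> e i (z i)) \<and> \<Psi> e d (\<not> z d)"

lemma first_difference:
  fixes x y :: "nat \<Rightarrow> bool"
  assumes "x \<noteq> y" "\<forall>k<m. x k = y k"
  obtains n where "m \<le> n" "x n \<noteq> y n" "\<forall>k<n. x k = y k"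
proof -
  have ex: "\<exists>n. x n \<noteq> y n" using assms(1) by auto
  define n where "n = (LEAST n. x n \<noteq> y n)"
  have "x n \<noteq> y n" unfolding n_def by (rule LeastI_ex[OF ex])
  moreover have "\<forall>k<n. x k = y k" unfolding n_def using not_less_Least by blast
  ultimately show ?thesis using that assms(2) by (meson not_less)
qed

text \<open>The real \<open>z j\<close> (with \<open>j\<close> read modulo 3) follows \<open>b j\<close> up to position \<open>n j\<close>, where it switches to
  \<open>b (j + 3)\<close>, an element of \<open>B (x j)\<close>. The number \<open>n (j + 1)\<close> bounds an index of \<open>b (j + 3)\<close>, and
  \<open>n (j + 2)\<close> bounds the positions at which smaller indices of other reals fail on \<open>b (j + 3)\<close>.\<close>

lemma coding_sequences:
  fixes \<Psi> :: "nat \<Rightarrow> nat \<Rightarrow> bool \<Rightarrow> bool" and B :: "bool \<Rightarrow> (nat \<Rightarrow> bool) set" and x :: "nat \<Rightarrow> bool"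
  assumes det: "\<And>e i u v. \<Psi> e i u \<Longrightarrow> \<Psi> e i v \<Longrightarrow> u = v"
    and index: "\<And>b i. b \<in> B i \<Longrightarrow> \<exists>e. col e = i \<and> (\<forall>k. \<Psi> e k (b k))"
    and colour: "\<And>b i e. b \<in> B i \<Longrightarrow> \<forall>k. \<Psi> e k (b k) \<Longrightarrow> col e = i"
    and dense: "\<And>b i j m. b \<in> B i \<Longrightarrow> \<exists>b'\<in>B j. b' \<noteq> b \<and> (\<forall>k<m. b' k = b k)"
    and ne: "B True \<noteq> {}"
  shows "\<exists>(z :: nat \<Rightarrow> nat \<Rightarrow> bool) n. (\<forall>j. z (j + 3) = z j) \<and>
     (\<forall>j m. \<exists>i. \<exists>b\<in>B i. \<forall>k<m. z j k = b k) \<and>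
     (\<forall>j. n (j + 2) \<le> n (j + 3) \<and> (\<exists>e<n (j + 1). departs \<Psi> e (z j) (n (j + 3)))) \<and>
     (\<forall>j d e. n (j + 2) \<le> d \<longrightarrow> e < n (j + 1) \<longrightarrow> departs \<Psi> e (z j) d \<longrightarrow> d = n (j + 3) \<and> col e = x j)"
proof -
  define U where "U = B True \<union> B False"
  have U: "b \<in> U \<longleftrightarrow> (\<exists>i. b \<in> B i)" for b by (auto simp: U_def ex_bool_eq)
  \<comment> \<open>\<open>D\<close> is a delay after which no index below \<open>E\<close> can
    still imitate \<open>b\<close> by accident.\<close>
  define W where "W b E D \<longleftrightarrow> (\<forall>e<E. (\<forall>i. \<Psi> e i (b i)) \<or> (\<exists>i<D. \<not> \<Psi> e i (b i)))" for b and E D :: nat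
  \<comment> \<open>A state lists the three elements being followed, the one to be replaced next
    coming first, and a position \<open>m\<close> before which the next switch may not
    occur.\<close>
  define st where "st j S S' \<longleftrightarrow> (case S of (u, v, w, m) \<Rightarrow> case S' of (u', v', w', m') \<Rightarrow>
     u' = v \<and> v' = w \<and> w' \<in> B (x j) \<and> (\<exists>n. m \<le> n \<and> n < m' \<and> u n \<noteq> w' n \<and> (\<forall>k<n. u k = w' k) \<and>
       (\<exists>e<m'. \<forall>i. \<Psi> e i (w' i)) \<and> W w n m'))"
    for j :: nat and S S' :: "(nat \<Rightarrow> bool) \<times> (nat \<Rightarrow> bool) \<times> (nat \<Rightarrow> bool) \<times> nat"
  have W_ex: "\<exists>D. W b E D" for b E
  proof -
    define f where "f e = (SOME i. \<not> \<Psi> e i (b i))" for e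
    have f: "\<not> \<Psi> e (f e) (b (f e))" if "\<not> (\<forall>i. \<Psi> e i (b i))" for e
      using that unfolding f_def not_all by (rule someI_ex)
    have "f e < Suc (\<Sum>e<E. f e)" if "e < E" for e
      using member_le_sum[of e "{..<E}" f] that by (simp add: le_imp_less_Suc)
    then have "W b E (Suc (\<Sum>e<E. f e))" unfolding W_def using f by blast
    then show ?thesis ..
  qed
  have W_mono: "W b E D \<Longrightarrow> D \<le> D' \<Longrightarrow> W b E D'" for b E D D'
    unfolding W_def by (meson order_less_le_trans)
  have "\<exists>F. \<forall>j. (case F j of (u, v, w, m) \<Rightarrow> u \<in> U \<and> v \<in> U \<and> w \<in> U) \<and> st j (F j) (F (Suc j))"
  proof (rule dependent_nat_choice)
    obtain b where "b \<in> U" using ne by (auto simp: U_def)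
    then show "\<exists>S :: (nat \<Rightarrow> bool) \<times> (nat \<Rightarrow> bool) \<times> (nat \<Rightarrow> bool) \<times> nat.
        case S of (u, v, w, m) \<Rightarrow> u \<in> U \<and> v \<in> U \<and> w \<in> U"
      by (intro exI[of _ "(b, b, b, 0)"]) simp
  next
    fix S :: "(nat \<Rightarrow> bool) \<times> (nat \<Rightarrow> bool) \<times> (nat \<Rightarrow> bool) \<times> nat" and j
    assume S: "case S of (u, v, w, m) \<Rightarrow> u \<in> U \<and> v \<in> U \<and> w \<in> U"
    obtain u v w m where S_eq: "S = (u, v, w, m)" by (cases S) auto
    have uvw: "u \<in> U" "v \<in> U" "w \<in> U" using S by (auto simp: S_eq)
    obtain w' where w': "w' \<in> B (x j)" "w' \<noteq> u" "\<forall>k<m. w' k = u k"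
      using dense[of u _ "x j" m] uvw(1) U by blast
    obtain n where n: "m \<le> n" "u n \<noteq> w' n" "\<forall>k<n. u k = w' k"
      using first_difference[of u w' m] w' by auto
    obtain e where e: "\<forall>i. \<Psi> e i (w' i)" using index[OF w'(1)] by blast
    obtain D where D: "W w n D" using W_ex by blast
    \<comment> \<open>The next switch has to come after this one, after the new index
      \<open>e\<close> and after the delay \<open>D\<close>.\<close>
    define m' where "m' = Suc (n + e + D)"
    have "st j S (v, w, w', m')"
      unfolding st_def S_eq prod.case
      using n w' e W_mono[OF D, of m'] by (intro conjI exI[of _ n] exI[of _ e]) (auto simp: m'_def)
    moreover have "w' \<in> U" using w'(1) U by blast
    ultimately show "\<exists>S'. (case S' of (u, v, w, m) \<Rightarrow> u \<in> U \<and> v \<in> U \<and> w \<in> U) \<and> st j S S'"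
      using uvw by (intro exI[of _ "(v, w, w', m')"]) simp
  qed
  then obtain F where "\<forall>j. (case F j of (u, v, w, m) \<Rightarrow> u \<in> U \<and> v \<in> U \<and> w \<in> U) \<and> st j (F j) (F (Suc j))" ..
  note F = this[rule_format, THEN conjunct1] this[rule_format, THEN conjunct2]
  define b v w m where "b j = fst (F j)" and "v j = fst (snd (F j))" and "w j = fst (snd (snd (F j)))"
    and "m j = snd (snd (snd (F j)))" for j
  have F_eq: "F j = (b j, v j, w j, m j)" for j by (simp add: b_def v_def w_def m_def)
  note step = F(2)[unfolded F_eq st_def prod.case]
  have b2: "w j = b (j + 2)" for j using step[of j] step[of "Suc j"] by simp
  have bU: "b j \<in> U" for j using F(1)[of j] by (simp add: F_eq)
  have "\<exists>n. m j \<le> n \<and> n < m (Suc j) \<and> b j n \<noteq> b (j + 3) n \<and> (\<forall>k<n. b j k = b (j + 3) k) \<and>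
       (\<exists>e<m (Suc j). \<forall>i. \<Psi> e i (b (j + 3) i)) \<and> W (b (j + 2)) n (m (Suc j)) \<and> b (j + 3) \<in> B (x j)" for j
  proof -
    have "b (j + 3) = w (Suc j)" by (simp add: b2 numeral_3_eq_3)
    then show ?thesis using step[of j] unfolding b2[symmetric] by simp
  qed
  then obtain n where n: "\<And>j. m j \<le> n j" "\<And>j. n j < m (Suc j)" "\<And>j. b j (n j) \<noteq> b (j + 3) (n j)"
    "\<And>j k. k < n j \<Longrightarrow> b j k = b (j + 3) k" "\<And>j. \<exists>e<m (Suc j). \<forall>i. \<Psi> e i (b (j + 3) i)"
    "\<And>j. W (b (j + 2)) (n j) (m (Suc j))" "\<And>j. b (j + 3) \<in> B (x j)"
    by metis
  have n_less: "n j < n (Suc j)" for j using n(1)[of "Suc j"] n(2)[of j] by simp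
  then have n_mono: "strict_mono n" by (simp add: strict_mono_Suc_iff)
  have n_ge: "j \<le> n j" for j using strict_mono_imp_increasing[OF n_mono] .
  \<comment> \<open>All later switches in the residue class of \<open>j\<close> happen at or beyond
    \<open>n j\<close>.\<close>
  have b_stable: "b (j + 3 * k) i = b j i" if "i < n j" for i j k
  proof (induction k)
    case (Suc k)
    have "i < n (j + 3 * k)"
      using that strict_mono_less_eq[OF n_mono, of j "j + 3 * k"] by simp
    then show ?case using n(4)[of i "j + 3 * k"] Suc by (simp add: algebra_simps)
  qed simp
  \<comment> \<open>Bit \<open>i\<close> of the limit is read off at stage \<open>Suc i\<close> of
    its residue class, because by \<open>n_ge\<close> the switches from there on lie beyond
    \<open>i\<close>.\<close>
  define z where "z j i = b (j mod 3 + 3 * Suc i) i" for j i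
  have z_eq: "z j i = b j i" if "i < n j" for i j
  proof -
    define l where "l = max (j div 3) (Suc i)"
    have "j div 3 \<le> l" by (simp add: l_def)
    then have j: "j mod 3 + 3 * l = j + 3 * (l - j div 3)" by presburger
    have "Suc i \<le> l" by (simp add: l_def)
    then have i: "j mod 3 + 3 * l = (j mod 3 + 3 * Suc i) + 3 * (l - Suc i)" by presburger
    have "i < n (j mod 3 + 3 * Suc i)" using n_ge[of "j mod 3 + 3 * Suc i"] by simp
    then have "b (j mod 3 + 3 * l) i = z j i" unfolding z_def i by (rule b_stable)
    moreover have "b (j mod 3 + 3 * l) i = b j i" unfolding j by (rule b_stable[OF that])
    ultimately show ?thesis by simp
  qed
  have z3: "z (j + 3) = z j" for j by (intro ext) (simp add: z_def)
  have zb: "z j i = b (j + 3) i" if "i < n (j + 3)" for i j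
    using z_eq[OF that] z3 by simp
  \<comment> \<open>At this position the limit follows \<open>b (j + 6)\<close>, which leaves
    \<open>b (j + 3)\<close> exactly there.\<close>
  have z_dep: "z j (n (j + 3)) \<noteq> b (j + 3) (n (j + 3))" for j
  proof -
    have "z j (n (j + 3)) = b (j + 3 + 3) (n (j + 3))"
      unfolding z3[of j, symmetric] by (rule zb) (use n_mono in \<open>simp add: strict_mono_less\<close>)
    then show ?thesis using n(3)[of "j + 3"] by simp
  qed
  have W3: "W (b (j + 3)) (n (j + 1)) (n (j + 2))" for j
    using n(6)[of "j + 1"] W_mono n(1)[of "j + 2"] by (simp add: numeral_3_eq_3)
  show ?thesis
  proof (intro exI[of _ z] exI[of _ n] conjI allI impI)
    fix j show "z (j + 3) = z j" by (rule z3)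
  next
    fix j l :: nat
    define J where "J = j + 3 * l"
    have "z j = z J"
      unfolding z_def J_def by simp
    moreover have "l \<le> n J" using n_ge[of J] by (simp add: J_def)
    ultimately have "\<forall>k<l. z j k = b J k" using z_eq[of _ J] by simp
    then show "\<exists>i. \<exists>b\<in>B i. \<forall>k<l. z j k = b k" using bU[of J] U by blast
  next
    fix j
    show "n (j + 2) \<le> n (j + 3)" using n_mono by (simp add: strict_mono_less_eq)
    obtain e where e: "e < m (Suc j)" "\<forall>i. \<Psi> e i (b (j + 3) i)" using n(5)[of j] by blast
    have "departs \<Psi> e (z j) (n (j + 3))"
      unfolding departs_def using e(2) zb[of _ j] z_dep[of j] by auto
    moreover have "e < n (j + 1)" using e(1) n(1)[of "Suc j"] by simp
    ultimately show "\<exists>e<n (j + 1). departs \<Psi> e (z j) (n (j + 3))" by blast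
  next
    fix j d e
    assume d: "n (j + 2) \<le> d" and e: "e < n (j + 1)" and dep: "departs \<Psi> e (z j) d"
    have less: "n (j + 2) < n (j + 3)" using n_mono by (simp add: strict_mono_less)
    have "\<Psi> e i (b (j + 3) i)" if "i < n (j + 2)" for i
    proof -
      have "\<Psi> e i (z j i)" using dep d that by (simp add: departs_def)
      then show ?thesis using zb[of i j] that less by simp
    qed
    \<comment> \<open>The index agrees with \<open>b (j + 3)\<close> below \<open>n (j + 2)\<close>,
      where by \<open>W3\<close> the delay is over; so it computes all of
      \<open>b (j + 3)\<close>.\<close>
    then have full: "\<forall>i. \<Psi> e i (b (j + 3) i)"
      using W3[of j] e unfolding W_def by blast
    show "col e = x j" by (rule colour[OF n(7) full])
    \<comment> \<open>An earlier departure would make \<open>e\<close> give both bits at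
      \<open>d\<close>; a later one would make it follow the limit through the switch, away from
      \<open>b (j + 3)\<close>.\<close>
    show "d = n (j + 3)"
    proof (rule linorder_cases[of d "n (j + 3)"])
      assume "d < n (j + 3)"
      then show ?thesis using det[of e d "\<not> z j d" "z j d"] dep full zb[of d j] by (simp add: departs_def)
    next
      assume "n (j + 3) < d"
      then have "\<Psi> e (n (j + 3)) (z j (n (j + 3)))" using dep by (simp add: departs_def)
      then show ?thesis using det full z_dep[of j] by blast
    qed
  qed
qed

section \<open>Indices for reductions to two oracles\<close>

definition joint_rel :: "(nat \<Rightarrow> bool) \<Rightarrow> (nat \<Rightarrow> bool) \<Rightarrow> nat \<Rightarrow> nat \<Rightarrow> bool \<Rightarrow> bool" where
  "joint_rel c d e i v \<longleftrightarrow>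
     univ_rel (if pfst e = 0 then c else d) (psnd e) (seq_code [i]) (if v then 1 else 0)"

lemma joint_rel_deterministic:
  assumes "joint_rel c d e i u" "joint_rel c d e i v" shows "u = v"
  using univ_rel_deterministic[OF assms[unfolded joint_rel_def]] by (cases u; cases v) simp_all

text \<open>The first component of an index names the oracle, 0 for \<open>c\<close> and anything
  else for \<open>d\<close>; this is the colour in \<open>coding_sequences\<close>. The second
  component is the program.\<close>

lemma turing_le_imp_index:
  assumes "turing_le b (if i then d else c)"
  shows "\<exists>e. (pfst e \<noteq> 0) = i \<and> (\<forall>k. joint_rel c d e k (b k))"
proof -
  obtain p where p: "\<And>k. eval (if i then d else c) p [k] (if b k then 1 else 0)"
    using assms unfolding turing_le_def by blast
  show ?thesis
    by (rule exI[of _ "pair (if i then 1 else 0) (prog_code p)"])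
      (use univ_rel_complete[OF p] in \<open>cases i; simp add: joint_rel_def\<close>)
qed

text \<open>\<open>b\<close> is computed by searching for certificates; determinism of
  \<open>univ_rel\<close> guarantees that any certificate found shows the right bit.\<close>

lemma index_imp_turing_le:
  assumes "\<forall>k. joint_rel c d e k (b k)"
  shows "turing_le b (if pfst e = 0 then c else d)"
proof -
  define A where "A = (if pfst e = 0 then c else d)"
  have cert: "\<exists>s. certifies A s (psnd e) (pair k 0) (if b k then 1 else 0)" for k
    using assms unfolding joint_rel_def univ_rel_iff_certifies A_def by (simp add: seq_code_def)
  have sound: "(v = 1) = b k" if "certifies A s (psnd e) (pair k 0) v" for k s v
  proof -
    have "v = (if b k then 1 else 0)"
      using that cert univ_rel_deterministic unfolding univ_rel_iff_certifies by metis
    then show ?thesis by simp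
  qed
  show ?thesis unfolding A_def[symmetric]
  proof (rule turing_leI_search)
    show "dec_in A [fst, snd] (\<lambda>p. \<exists>v<2. certifies A (snd p) (psnd e) (pair (fst p) 0) v)"
      by (intro comp_rules dec_in_certifies[OF turing_le_refl]) (simp_all add: comp_in_var)
    show "dec_in A [fst, snd] (\<lambda>p. certifies A (snd p) (psnd e) (pair (fst p) 0) 1)"
      by (intro comp_rules dec_in_certifies[OF turing_le_refl]) (simp_all add: comp_in_var)
    show "\<exists>s. \<exists>v<2. certifies A s (psnd e) (pair k 0) v" for k
    proof -
      have "(if b k then 1 else 0) < (2 :: nat)" by simp
      then show ?thesis using cert[of k] by blast
    qed
    show "certifies A s (psnd e) (pair k 0) 1 \<longleftrightarrow> b k"
      if *: "\<exists>v<2. certifies A s (psnd e) (pair k 0) v" for k s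
    proof -
      obtain v where v: "v < 2" "certifies A s (psnd e) (pair k 0) v" using * by blast
      then have "v = (if b k then 1 else 0)" using sound[OF v(2)] by (cases "b k") simp_all
      then show ?thesis using v(2) sound[of s k 1] by (cases "b k") auto
    qed
  qed
qed

text \<open>The two cases keep the oracle fixed in each of them, because
  \<open>dec_in_certifies\<close> treats one fixed oracle at a time.\<close>

definition joint_cert :: "(nat \<Rightarrow> bool) \<Rightarrow> (nat \<Rightarrow> bool) \<Rightarrow> nat \<Rightarrow> nat \<Rightarrow> nat \<Rightarrow> nat \<Rightarrow> bool" where
  "joint_cert c d s e i v \<longleftrightarrow> pfst e = 0 \<and> certifies c s (psnd e) (pair i 0) v \<or>
     pfst e \<noteq> 0 \<and> certifies d s (psnd e) (pair i 0) v"

lemma joint_rel_iff_cert: "joint_rel c d e i v \<longleftrightarrow> (\<exists>s. joint_cert c d s e i (if v then 1 else 0))"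
  unfolding joint_rel_def joint_cert_def univ_rel_iff_certifies
  by (cases "pfst e = 0") (simp_all add: seq_code_def)

lemma dec_in_joint_cert:
  assumes "turing_le c A" "turing_le d A"
    and "comp_in A vs S" "comp_in A vs E" "comp_in A vs I" "comp_in A vs V"
  shows "dec_in A vs (\<lambda>e. joint_cert c d (S e) (E e) (I e) (V e))"
  unfolding joint_cert_def by (intro comp_rules dec_in_certifies assms)

text \<open>Separate reductions for the \<open>z j\<close> need not be uniform in \<open>j\<close>,
  but only three reals occur, and a case distinction on the residue of \<open>j\<close> modulo 3
  combines their reductions.\<close>

lemma dec_in_periodic:
  fixes z :: "nat \<Rightarrow> nat \<Rightarrow> bool"
  assumes z: "\<And>j. turing_le (z j) A" "\<And>j. z (j + 3) = z j" and "comp_in A vs J" "comp_in A vs I"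
  shows "dec_in A vs (\<lambda>e. z (J e) (I e))"
proof -
  have eq: "z j = z (j mod 3)" for j
  proof (induction j rule: less_induct)
    case (less j)
    show ?case
    proof (cases "j < 3")
      case False
      then have "z j = z (j - 3)" using z(2)[of "j - 3"] by simp
      also have "\<dots> = z (j mod 3)" using less[of "j - 3"] False by (simp add: le_mod_geq)
      finally show ?thesis .
    qed simp
  qed
  have "dec_in A [fst, snd] (\<lambda>p. (\<exists>q<Suc (fst p). fst p = q + q + q \<and> z 0 (snd p)) \<or>
      (\<exists>q<Suc (fst p). fst p = Suc (q + q + q) \<and> z 1 (snd p)) \<or>
      (\<exists>q<Suc (fst p). fst p = Suc (Suc (q + q + q)) \<and> z 2 (snd p)))"
    by (intro comp_rules dec_in_oracle z(1)) (simp_all add: comp_in_var)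
  moreover have "(\<exists>q<Suc j. j = q + q + q \<and> z 0 i) \<or> (\<exists>q<Suc j. j = Suc (q + q + q) \<and> z 1 i) \<or>
      (\<exists>q<Suc j. j = Suc (Suc (q + q + q)) \<and> z 2 i) \<longleftrightarrow> z j i" for i j
  proof -
    have 0: "(\<exists>q<Suc j. j = q + q + q) \<longleftrightarrow> j mod 3 = 0"
      and 1: "(\<exists>q<Suc j. j = Suc (q + q + q)) \<longleftrightarrow> j mod 3 = 1"
      and 2: "(\<exists>q<Suc j. j = Suc (Suc (q + q + q))) \<longleftrightarrow> j mod 3 = 2" by presburger+
    have "j mod 3 = 0 \<or> j mod 3 = 1 \<or> j mod 3 = 2" by presburger
    then show ?thesis using 0 1 2 eq[of j] by (elim disjE) (simp_all, blast+)
  qed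
  ultimately have "dec_in A [fst, snd] (\<lambda>p. z (fst p) (snd p))" by simp
  from dec_in_subst[OF this, where h = "\<lambda>e. (J e, I e)" and vs = vs] assms(3,4)
  show ?thesis by simp
qed

text \<open>Given \<open>n (j + 1)\<close> and \<open>n (j + 2)\<close>, the position
  \<open>n (j + 3)\<close> is the only admissible departure from \<open>z j\<close>, and the colour
  of the departing index is bit \<open>j\<close>. Starting from the constants \<open>n 0\<close>,
  \<open>n 1\<close> and \<open>n 2\<close>, this recovers \<open>x\<close>.\<close>

lemma turing_le_decode:
  fixes z :: "nat \<Rightarrow> nat \<Rightarrow> bool" and n :: "nat \<Rightarrow> nat"
  assumes c: "turing_le c A" "turing_le d A"
    and z: "\<And>j. turing_le (z j) A" "\<And>j. z (j + 3) = z j"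
    and ex: "\<And>j. n (j + 2) \<le> n (j + 3) \<and> (\<exists>e<n (j + 1). departs (joint_rel c d) e (z j) (n (j + 3)))"
    and unique: "\<And>j k e. n (j + 2) \<le> k \<Longrightarrow> e < n (j + 1) \<Longrightarrow> departs (joint_rel c d) e (z j) k \<Longrightarrow>
       k = n (j + 3) \<and> (pfst e \<noteq> 0) = x j"
  shows "turing_le x A"
proof -
  \<comment> \<open>Bounding the certificates by \<open>w\<close> turns \<open>departs\<close> into
    a decidable condition.\<close>
  define dep where "dep w e j k \<longleftrightarrow>
      (\<forall>i<k. \<exists>s<w. joint_cert c d s e i (if z j i then 1 else 0)) \<and>
      (\<exists>s<w. joint_cert c d s e k (if z j k then 0 else 1))" for w e j k
  have dep_dec: "dec_in A vs (\<lambda>e. dep (W e) (E e) (J e) (K e))"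
    if "comp_in A vs W" "comp_in A vs E" "comp_in A vs J" "comp_in A vs K"
    for vs and W E J K :: "'e \<Rightarrow> nat"
  proof -
    have "dec_in A [\<lambda>l. l ! 0, \<lambda>l. l ! 1, \<lambda>l. l ! 2, \<lambda>l. l ! 3] (\<lambda>l. dep (l ! 0) (l ! 1) (l ! 2) (l ! 3))"
      unfolding dep_def
      by (intro comp_rules dec_in_joint_cert c dec_in_periodic[of z] z) (simp_all add: comp_in_var)
    from dec_in_subst[OF this, where h = "\<lambda>e. [W e, E e, J e, K e]" and vs = vs] that
    show ?thesis by simp
  qed
  have not_if: "(if z j k then 0 else 1) = (if \<not> z j k then 1 else 0 :: nat)" for j k by simp
  have depD: "departs (joint_rel c d) e (z j) k" if "dep w e j k" for w e j k
    using that unfolding dep_def departs_def joint_rel_iff_cert not_if by blast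
  show ?thesis
  proof (rule turing_leI_search)
    \<comment> \<open>\<open>s\<close> pairs a guess for the values \<open>n 0\<close> to
      \<open>n (k + 3)\<close> with a bound on certificates.\<close>
    let ?G = "\<lambda>k s. entry (pfst s) 0 = n 0 \<and> entry (pfst s) 1 = n 1 \<and> entry (pfst s) 2 = n 2 \<and>
      (\<forall>j<Suc k. entry (pfst s) (j + 2) \<le> entry (pfst s) (j + 3) \<and>
        (\<exists>e<entry (pfst s) (j + 1). dep (psnd s) e j (entry (pfst s) (j + 3))))"
    let ?Q = "\<lambda>k s. \<exists>e<entry (pfst s) (k + 1). \<not> pfst e = 0 \<and> dep (psnd s) e k (entry (pfst s) (k + 3))"
    show "dec_in A [fst, snd] (\<lambda>p. ?G (fst p) (snd p))"
      by (intro comp_rules dep_dec) (simp_all add: comp_in_var)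
    show "dec_in A [fst, snd] (\<lambda>p. ?Q (fst p) (snd p))"
      by (intro comp_rules dep_dec) (simp_all add: comp_in_var)
    show "?Q k s \<longleftrightarrow> x k" if G: "?G k s" for k s
    proof -
      \<comment> \<open>A guess that passes the test is correct: each entry from the fourth on is
        forced by \<open>unique\<close> from its predecessors.\<close>
      have n_eq: "j < k + 4 \<Longrightarrow> entry (pfst s) j = n j" for j
      proof (induction j rule: less_induct)
        case (less j)
        show ?case
        proof (cases "j < 3")
          case True
          then have "j = 0 \<or> j = 1 \<or> j = 2" by auto
          then show ?thesis using G by auto
        next
          case False
          define i where "i = j - 3"
          have j: "j = i + 3" "i < Suc k" using False less.prems by (auto simp: i_def)
          obtain e where e: "entry (pfst s) (i + 2) \<le> entry (pfst s) (i + 3)" "e < entry (pfst s) (i + 1)"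
            "dep (psnd s) e i (entry (pfst s) (i + 3))" using G j(2) by blast
          have "entry (pfst s) (i + 1) = n (i + 1)" "entry (pfst s) (i + 2) = n (i + 2)"
            using less j by simp_all
          then show ?thesis using unique[OF _ _ depD[OF e(3)]] e(1,2) j(1) by simp
        qed
      qed
      have n: "entry (pfst s) (k + 1) = n (k + 1)" "entry (pfst s) (k + 3) = n (k + 3)"
        by (simp_all add: n_eq)
      have col: "(pfst e \<noteq> 0) = x k" if "e < n (k + 1)" "dep (psnd s) e k (n (k + 3))" for e
        using unique[OF _ that(1) depD[OF that(2)]] ex[of k] by simp
      obtain e where "e < n (k + 1)" "dep (psnd s) e k (n (k + 3))"
        using G n by auto
      then show ?thesis unfolding n using col by blast
    qed
    show "\<exists>s. ?G k s" for k
    proof -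
      obtain e where e: "\<And>j. e j < n (j + 1)" "\<And>j. departs (joint_rel c d) (e j) (z j) (n (j + 3))"
        using ex by metis
      have "\<exists>s. (i < n (j + 3) \<longrightarrow> joint_cert c d s (e j) i (if z j i then 1 else 0)) \<and>
        (i = n (j + 3) \<longrightarrow> joint_cert c d s (e j) i (if z j i then 0 else 1))" for i j
        using e(2)[of j] unfolding departs_def joint_rel_iff_cert not_if by (cases "i < n (j + 3)") auto
      then obtain s where s: "\<And>i j. i < n (j + 3) \<Longrightarrow> joint_cert c d (s i j) (e j) i (if z j i then 1 else 0)"
        "\<And>i j. i = n (j + 3) \<Longrightarrow> joint_cert c d (s i j) (e j) i (if z j i then 0 else 1)" by metis
      \<comment> \<open>Finitely many certificates confirm the true positions up to
        \<open>n (k + 3)\<close>; \<open>w\<close> is chosen above all of them.\<close>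
      define S where "S = (\<Union>j<Suc k. (\<lambda>i. s i j) ` {..n (j + 3)})"
      have "finite S" by (simp add: S_def)
      then obtain w where w: "\<And>t. t \<in> S \<Longrightarrow> t < w" unfolding finite_nat_set_iff_bounded by blast
      have dep: "dep w (e j) j (n (j + 3))" if "j < Suc k" for j
      proof -
        have "s i j < w" if "i \<le> n (j + 3)" for i
          using \<open>j < Suc k\<close> that by (intro w) (auto simp: S_def)
        then show ?thesis unfolding dep_def using s(1)[of _ j] s(2)[OF refl, of j]
          by (metis order_less_imp_le order_refl)
      qed
      have ent: "entry (seq_code (map n [0..<k + 4])) j = n j" if "j < k + 4" for j
        using that by (simp add: entry_seq_code del: upt_Suc)
      show ?thesis
      proof (rule exI[of _ "pair (seq_code (map n [0..<k + 4])) w"],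
          unfold pair_simps, intro conjI allI impI)
        fix j assume j: "j < Suc k"
        show "\<exists>e<entry (seq_code (map n [0..<k + 4])) (j + 1).
            dep w e j (entry (seq_code (map n [0..<k + 4])) (j + 3))"
          using dep[OF j] e(1)[of j] j by (auto simp: ent)
      qed (use ex in \<open>simp_all add: ent\<close>)
    qed
  qed
qed

section \<open>Closed images and dense subsets\<close>

text \<open>As in the Cantor-Bendixson theorem, the set \<open>P\<close> of condensation points
  contains all but countably many elements of \<open>S\<close>. Choosing a point of \<open>P\<close>
  from each uncountable cylinder, and then another one that avoids all first choices, gives two
  countable sets dense in \<open>P\<close>.\<close>

lemma uncountable_dense_pair:
  fixes S :: "(nat \<Rightarrow> bool) set"
  assumes unc: "uncountable S"
  obtains B :: "bool \<Rightarrow> (nat \<Rightarrow> bool) set" where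
    "\<And>i. B i \<subseteq> S" "\<And>i. countable (B i)" "B False \<inter> B True = {}" "B True \<noteq> {}"
    "\<forall>i j m. \<forall>b\<in>B i. \<exists>b'\<in>B j. b' \<noteq> b \<and> (\<forall>k<m. b' k = b k)"
proof -
  define cyl where "cyl s = {a \<in> S. \<forall>k<length s. a k = s ! k}" for s :: "bool list"
  define G where "G = {s. uncountable (cyl s)}"
  define P where "P = {a \<in> S. \<forall>s. a \<in> cyl s \<longrightarrow> s \<in> G}"
  have "S - P \<subseteq> (\<Union>s\<in>-G. cyl s)" by (auto simp: P_def cyl_def)
  moreover have "countable (\<Union>s\<in>-G. cyl s)" by (rule countable_UN) (auto simp: G_def)
  ultimately have SP: "countable (S - P)" by (rule countable_subset)
  have big: "uncountable (cyl s \<inter> P)" if "s \<in> G" for s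
  proof
    assume "countable (cyl s \<inter> P)"
    moreover have "countable (cyl s - P)"
      using SP by (rule countable_subset[rotated]) (auto simp: cyl_def)
    ultimately have "countable (cyl s \<inter> P \<union> (cyl s - P))" by (rule countable_Un)
    then show False using that by (simp add: G_def Int_Diff_Un)
  qed
  have "\<exists>b. b \<in> cyl s \<inter> P" if "s \<in> G" for s using big[OF that] by (metis countable_empty equals0I)
  then obtain b0 where b0: "\<And>s. s \<in> G \<Longrightarrow> b0 s \<in> cyl s \<inter> P" by metis
  have c0: "countable (b0 ` G)" by simp
  have "\<exists>b. b \<in> cyl s \<inter> P - b0 ` G" if "s \<in> G" for s
    using uncountable_minus_countable[OF big[OF that] c0] by (metis countable_empty equals0I)
  then obtain b1 where b1: "\<And>s. s \<in> G \<Longrightarrow> b1 s \<in> cyl s \<inter> P - b0 ` G" by metis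
  define \<beta> where "\<beta> i = (if i then b1 else b0)" for i
  have \<beta>: "\<beta> i s \<in> cyl s" "\<beta> i s \<in> P" if "s \<in> G" for i s
    using b0[OF that] b1[OF that] by (auto simp: \<beta>_def)
  define B where "B i = \<beta> i ` G" for i
  show ?thesis
  proof (rule that[of B])
    show "B i \<subseteq> S" for i using \<beta>(1) by (auto simp: B_def cyl_def)
    show "countable (B i)" for i by (simp add: B_def)
    have "B False = b0 ` G" "B True \<inter> b0 ` G = {}" using b1 by (auto simp: B_def \<beta>_def)
    then show "B False \<inter> B True = {}" by blast
    have "cyl [] = S" by (auto simp: cyl_def)
    then have "[] \<in> G" using unc by (simp add: G_def)
    then show "B True \<noteq> {}" by (auto simp: B_def)
    show "\<forall>i j m. \<forall>b\<in>B i. \<exists>b'\<in>B j. b' \<noteq> b \<and> (\<forall>k<m. b' k = b k)"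
    proof (intro allI ballI)
      fix b i j and m :: nat assume "b \<in> B i"
      then have bP: "b \<in> P" using \<beta>(2) by (auto simp: B_def)
      have "b \<in> cyl (map b [0..<m])" using bP by (auto simp: cyl_def P_def)
      then have "map b [0..<m] \<in> G" using bP by (auto simp: P_def)
      then have "uncountable (cyl (map b [0..<m]) \<inter> P - {b})"
        by (intro uncountable_minus_countable big) auto
      then have "cyl (map b [0..<m]) \<inter> P - {b} \<noteq> {}" by (intro notI) (simp only: countable_empty not_True_eq_False)
      then obtain a where a: "a \<in> cyl (map b [0..<m])" "a \<in> P" "a \<noteq> b" by blast
      obtain n where n: "a n \<noteq> b n" using a(3) by auto
      \<comment> \<open>The cylinder around \<open>a\<close> extends past a position where
        \<open>a\<close> differs from \<open>b\<close>, so any point chosen in it differs from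
        \<open>b\<close> too.\<close>
      define s where "s = map a [0..<max m (Suc n)]"
      have "a \<in> cyl s" using a(2) by (auto simp: cyl_def P_def s_def)
      then have s: "s \<in> G" using a(2) by (auto simp: P_def)
      have "\<forall>k<max m (Suc n). \<beta> j s k = a k" using \<beta>(1)[OF s, of j] by (auto simp: cyl_def s_def)
      moreover have "\<forall>k<m. a k = b k" using a(1) by (simp add: cyl_def)
      ultimately have "\<beta> j s \<noteq> b" "\<forall>k<m. \<beta> j s k = b k" using n by auto
      then show "\<exists>b'\<in>B j. b' \<noteq> b \<and> (\<forall>k<m. b' k = b k)" using s unfolding B_def by blast
    qed
  qed
qed

text \<open>A form of Lusin's theorem: \<open>F\<close> is continuous on a compact set of positive measure.\<close>

lemma borel_closed_image:
  fixes F :: "real \<Rightarrow> nat \<Rightarrow> bool"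
  assumes meas: "\<And>n. {r. F r n} \<in> sets borel"
  obtains K where "K \<subseteq> {0..1}" "uncountable K"
    "\<forall>z. (\<forall>m. \<exists>r\<in>K. \<forall>k<m. z k = F r k) \<longrightarrow> (\<exists>r\<in>K. F r = z)"
proof -
  have leb: "X \<in> sets lebesgue" if "X \<in> sets borel" for X :: "real set"
    using that by (simp add: sets_completionI_sets)
  define S where "S v n = {0..1} \<inter> {r. F r n = v}" for v n
  have S_borel: "S v n \<in> sets borel" for v n
  proof -
    have "{r. F r n = v} = (if v then {r. F r n} else - {r. F r n})" by auto
    then have "{r. F r n = v} \<in> sets borel" using meas[of n] by (auto simp: borel_comp)
    then show ?thesis by (simp add: S_def)
  qed
  \<comment> \<open>Inner regularity. The error \<open>(1/2) ^ (n + 3)\<close>, made twice for each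
    bit, sums to 1/2, less than the measure of the unit interval.\<close>
  have "\<exists>T. closed T \<and> T \<subseteq> S v n \<and> emeasure lebesgue (S v n - T) < ennreal ((1/2) ^ (n + 3))" for v n
  proof -
    have "S v n \<in> sets lebesgue" by (rule leb[OF S_borel])
    from sets_lebesgue_inner_closed[OF this, of "(1/2) ^ (n + 3)"]
    show ?thesis by (metis half_gt_zero zero_less_one zero_less_power)
  qed
  then obtain T where T: "\<And>v n. closed (T v n)" "\<And>v n. T v n \<subseteq> S v n"
    "\<And>v n. emeasure lebesgue (S v n - T v n) < ennreal ((1/2) ^ (n + 3))" by metis
  define K where "K = (\<Inter>n. T True n \<union> T False n)"
  define U where "U n = (S True n - T True n) \<union> (S False n - T False n)" for n
  have T_leb: "T v n \<in> sets lebesgue" for v n using T(1) by (intro leb borel_closed)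
  have S_leb: "S v n \<in> sets lebesgue" for v n by (rule leb[OF S_borel])
  have U_leb: "U n \<in> sets lebesgue" for n unfolding U_def using T_leb S_leb by blast
  have K_sub: "K \<subseteq> {0..1}" using T(2) by (force simp: K_def S_def)
  have K_closed: "closed K" unfolding K_def using T(1) by (intro closed_INT ballI closed_Un) auto
  have K_leb: "K \<in> sets lebesgue" using K_closed by (intro leb borel_closed)
  have "compact K" using K_closed K_sub by (meson bounded_closed_interval bounded_subset compact_eq_bounded_closed)
  have cover: "{0..1} \<subseteq> K \<union> (\<Union>n. U n)" by (auto simp: K_def U_def S_def)
  have U_small: "emeasure lebesgue (U n) \<le> ennreal ((1/2) ^ (n + 2))" for n
  proof -
    have "emeasure lebesgue (U n) \<le> emeasure lebesgue (S True n - T True n) + emeasure lebesgue (S False n - T False n)"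
      unfolding U_def using T_leb S_leb by (intro emeasure_subadditive) auto
    also have "\<dots> \<le> ennreal ((1/2) ^ (n + 3)) + ennreal ((1/2) ^ (n + 3))"
      using T(3) by (intro add_mono less_imp_le)
    also have "\<dots> = ennreal ((1/2) ^ (n + 3) + (1/2) ^ (n + 3))" by (rule ennreal_plus[symmetric]) auto
    also have "(1/2) ^ (n + 3) + (1/2) ^ (n + 3) = (1/2::real) ^ (n + 2)"
      by (simp add: power_add power3_eq_cube power2_eq_square)
    finally show ?thesis .
  qed
  have "uncountable K"
  proof
    assume "countable K"
    then have "emeasure lebesgue K = 0"
      by (intro null_setsD1 null_sets_completionI countable_imp_null_set_lborel)
    have "emeasure lebesgue {0..1::real} \<le> emeasure lebesgue (K \<union> (\<Union>n. U n))"
      using cover K_leb U_leb by (intro emeasure_mono) auto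
    also have "\<dots> \<le> emeasure lebesgue K + emeasure lebesgue (\<Union>n. U n)"
      using K_leb U_leb by (intro emeasure_subadditive) auto
    also have "\<dots> \<le> 0 + (\<Sum>n. emeasure lebesgue (U n))"
      unfolding \<open>emeasure lebesgue K = 0\<close>
      by (intro add_left_mono emeasure_subadditive_countably) (use U_leb in blast)
    also have "\<dots> \<le> (\<Sum>n. ennreal ((1/2) ^ (n + 2)))"
      unfolding add_0 by (intro suminf_le U_small summableI)
    also have "\<dots> = ennreal (1/2)"
    proof -
      have "(\<lambda>n. (1/2::real) ^ (n + 2)) sums (1/2)"
        using sums_mult[OF geometric_sums[of "1/2::real"], of "1/4"] by (simp add: power_add)
      then show ?thesis by (intro suminf_ennreal_eq) auto
    qed
    also have "\<dots> < ennreal 1" by (rule ennreal_lessI) auto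
    finally show False by simp
  qed
  moreover have "\<exists>r\<in>K. F r = z" if z: "\<forall>m. \<exists>r\<in>K. \<forall>k<m. z k = F r k" for z
  proof -
    obtain \<rho> where \<rho>: "\<And>m. \<rho> m \<in> K" "\<And>m k. k < m \<Longrightarrow> z k = F (\<rho> m) k" using z by metis
    obtain r s where r: "r \<in> K" "strict_mono s" "(\<rho> \<circ> s) \<longlonglongrightarrow> r"
      using \<open>compact K\<close> \<rho>(1) unfolding compact_def by blast
    \<comment> \<open>On \<open>K\<close> both values of bit \<open>n\<close> are taken on
      relatively closed sets, so each bit is continuous there.\<close>
    have T_iff: "q \<in> T v n \<longleftrightarrow> F q n = v" if "q \<in> K" for q v n
      using that T(2)[of True n] T(2)[of False n] by (cases v) (auto simp: K_def S_def)
    have "F r n = z n" for n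
    proof -
      have "(\<lambda>i. \<rho> (s (i + Suc n))) \<longlonglongrightarrow> r"
        using LIMSEQ_ignore_initial_segment[OF r(3), of "Suc n"] by (simp add: comp_def)
      moreover have "\<rho> (s (i + Suc n)) \<in> T (z n) n" for i
      proof -
        have "n < s (i + Suc n)" using strict_mono_imp_increasing[OF r(2), of "i + Suc n"] by simp
        then show ?thesis using T_iff[OF \<rho>(1)] \<rho>(2) by simp
      qed
      ultimately have "r \<in> T (z n) n" using T(1) by (meson closed_sequentially)
      then show ?thesis using T_iff[OF r(1)] by simp
    qed
    then show ?thesis using r(1) by blast
  qed
  ultimately show ?thesis using that K_sub by blast
qed

section \<open>The partial order\<close>

text \<open>The first two bits of a point give its level, the others a sequence of points. A point of
  positive level lies above the points of smaller level in its sequence.\<close>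

definition level :: "(nat \<Rightarrow> bool) \<Rightarrow> nat" where
  "level y = (if y 0 then if y 1 then 2 else 1 else 0)"

definition row :: "(nat \<Rightarrow> bool) \<Rightarrow> nat \<Rightarrow> nat \<Rightarrow> bool" where
  "row y i n = y (2 + prod_encode (i, n))"

definition child :: "(nat \<Rightarrow> bool) \<Rightarrow> (nat \<Rightarrow> bool) \<Rightarrow> bool" where
  "child x y \<longleftrightarrow> level x < level y \<and> (\<exists>i. x = row y i)"

text \<open>The intermediate point is named as a row of \<open>y\<close>, so that the quantifier
  ranges over numbers and the relation is visibly Borel; \<open>ord3_iff\<close> is the form with an
  arbitrary point.\<close>

definition ord3 :: "(nat \<Rightarrow> bool) rel" where
  "ord3 = {(x, y). x = y \<or> child x y \<or> (\<exists>i. child x (row y i) \<and> child (row y i) y)}"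

text \<open>The test \<open>n < l\<close> writes the level in unary into the first two bits: none,
  the first, or both are set.\<close>

definition node :: "nat \<Rightarrow> (nat \<Rightarrow> nat \<Rightarrow> bool) \<Rightarrow> nat \<Rightarrow> bool" where
  "node l p n = (if n < 2 then n < l else p (fst (prod_decode (n - 2))) (snd (prod_decode (n - 2))))"

lemma level_node: "l \<le> 2 \<Longrightarrow> level (node l p) = l"
  by (auto simp: level_def node_def)

lemma row_node: "row (node l p) i = p i"
  by (auto simp: row_def node_def)

lemma child_node: "l \<le> 2 \<Longrightarrow> child x (node l p) \<longleftrightarrow> level x < l \<and> (\<exists>i. x = p i)"
  by (simp add: child_def level_node row_node)

lemma level_le: "level y \<le> 2"
  by (simp add: level_def)

lemma ord3_iff: "(x, y) \<in> ord3 \<longleftrightarrow> x = y \<or> child x y \<or> (\<exists>w. child x w \<and> child w y)"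
  unfolding ord3_def child_def by blast

lemma child_level: "child x y \<Longrightarrow> level x < level y"
  by (simp add: child_def)

lemma ord3_level: "(x, y) \<in> ord3 \<Longrightarrow> x \<noteq> y \<Longrightarrow> level x < level y"
  unfolding ord3_iff using child_level by (meson order_less_trans)

text \<open>A link through an intermediate point raises the level by at least two. As levels are at
  most 2, two consecutive strict relations are both instances of \<open>child\<close>, and
  \<open>ord3\<close> admits their composite.\<close>

lemma partial_order_ord3: "partial_order_on UNIV ord3"
  unfolding partial_order_on_def preorder_on_def
proof (intro conjI)
  show "refl_on UNIV ord3" by (auto simp: refl_on_def ord3_iff)
  show "antisym ord3" by (rule antisymI) (metis ord3_level order_less_asym)
  show "trans ord3"
  proof (rule transI)
    fix x y z assume xy: "(x, y) \<in> ord3" and yz: "(y, z) \<in> ord3"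
    show "(x, z) \<in> ord3"
    proof (cases "x = y \<or> y = z")
      case False
      have "child x y"
      proof (rule ccontr)
        assume "\<not> child x y"
        then obtain w where "child x w" "child w y" using xy False unfolding ord3_iff by blast
        then have "level x < level w" "level w < level y" by (simp_all add: child_level)
        then show False using ord3_level[OF yz] False level_le[of z] by simp
      qed
      moreover have "child y z"
      proof (rule ccontr)
        assume "\<not> child y z"
        then obtain w where "child y w" "child w z" using yz False unfolding ord3_iff by blast
        then have "level y < level w" "level w < level z" by (simp_all add: child_level)
        then show False using ord3_level[OF xy] False level_le[of z] by simp
      qed
      ultimately show ?thesis unfolding ord3_iff by blast
    qed (use xy yz in auto)
  qed
qed auto

lemma locally_countable_ord3: "locally_countable UNIV ord3"
  unfolding locally_countable_def
proof
  fix y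
  have "{x \<in> UNIV. (x, y) \<in> ord3 \<and> x \<noteq> y} \<subseteq> range (row y) \<union> (\<Union>i. range (row (row y i)))"
    unfolding ord3_iff child_def by blast
  then show "countable {x \<in> UNIV. (x, y) \<in> ord3 \<and> x \<noteq> y}"
    by (rule countable_subset) simp
qed

lemma has_height_ord3: "has_height UNIV ord3 3"
  unfolding has_height_def
proof (intro conjI allI impI)
  define a b c where "a = node 0 (\<lambda>i n. False)" and "b = node 1 (\<lambda>i. a)" and "c = node 2 (\<lambda>i. b)"
  have lev: "level a = 0" "level b = 1" "level c = 2" by (simp_all add: a_def b_def c_def level_node)
  have "child a b" unfolding b_def using lev(1) by (subst child_node) simp_all
  moreover have "child b c" unfolding c_def using lev(2) by (subst child_node) simp_all
  ultimately have "is_chain_in UNIV ord3 {a, b, c}" unfolding is_chain_in_def ord3_iff by blast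
  moreover have "card {a, b, c} = 3"
  proof -
    have "a \<noteq> b" "a \<noteq> c" "b \<noteq> c" using lev by auto
    then show ?thesis by simp
  qed
  ultimately show "\<exists>C. is_chain_in UNIV ord3 C \<and> finite C \<and> card C = 3" by blast
next
  fix C assume C: "is_chain_in UNIV ord3 C"
  have inj: "inj_on level C"
    using C ord3_level unfolding is_chain_in_def by (metis inj_onI less_irrefl)
  have sub: "level ` C \<subseteq> {..2}" using level_le by auto
  show "finite C" using inj sub by (meson finite_atMost finite_imageD finite_subset)
  have "card C = card (level ` C)" using inj by (simp add: card_image)
  also have "\<dots> \<le> card {..2::nat}" using sub by (intro card_mono) auto
  finally show "card C \<le> 3" by simp
qed

section \<open>Borel measurability of the order\<close>

lemma sets_cantor_bit: "{x. x n} \<in> sets cantor"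
  unfolding cantor_def by auto

lemma space_cantor: "space cantor = UNIV"
  by (simp add: cantor_def space_measure_of_conv)

lemma measurable_cantor_bit: "(\<lambda>x. x n) \<in> measurable cantor (count_space UNIV)"
  by (simp add: pred_def space_cantor sets_cantor_bit)

lemma borel_ord3: "ord3 \<in> sets cantor2"
proof -
  have bits [measurable]: "(\<lambda>p. fst p n) \<in> measurable cantor2 (count_space UNIV)"
    "(\<lambda>p. snd p n) \<in> measurable cantor2 (count_space UNIV)" for n :: nat
    by (rule measurable_compose[OF _ measurable_cantor_bit], simp)+
  \<comment> \<open>Comparison of levels becomes a Boolean combination of bits; equality of points
    is later unfolded to a countable conjunction over bits.\<close>
  have less: "level x < level y \<longleftrightarrow> (\<not> x 0 \<and> y 0) \<or> (x 0 \<and> \<not> x 1 \<and> y 0 \<and> y 1)" for x y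
    by (auto simp: level_def)
  have "ord3 = {p \<in> space cantor2. fst p = snd p \<or> child (fst p) (snd p) \<or>
      (\<exists>i. child (fst p) (row (snd p) i) \<and> child (row (snd p) i) (snd p))}"
    by (simp add: ord3_def space_pair_measure space_cantor case_prod_unfold)
  also have "\<dots> \<in> sets cantor2"
    unfolding child_def less row_def fun_eq_iff by measurable
  finally show ?thesis .
qed

lemma borel_partial_order_ord3: "borel_partial_order UNIV ord3"
  unfolding borel_partial_order_def
  using partial_order_ord3 borel_ord3 sets.top[of cantor] by (simp add: space_cantor)

section \<open>No Borel embedding\<close>

text \<open>Separation of \<open>B False\<close> from \<open>B True\<close> by the two oracles gives
  each index a colour, closedness of \<open>S\<close> captures the limits built by
  \<open>coding_sequences\<close>, and \<open>turing_le_decode\<close> reads \<open>x\<close>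
  back.\<close>

lemma closed_set_codes_every_real:
  fixes B :: "bool \<Rightarrow> (nat \<Rightarrow> bool) set" and c :: "bool \<Rightarrow> nat \<Rightarrow> bool" and x :: "nat \<Rightarrow> bool"
  assumes closed: "\<And>z. (\<And>m. \<exists>a\<in>S. \<forall>k<m. z k = a k) \<Longrightarrow> z \<in> S"
    and sub: "\<And>i. B i \<subseteq> S"
    and c: "\<And>i b. b \<in> B i \<Longrightarrow> turing_le b (c i)" "\<And>i b. b \<in> B i \<Longrightarrow> \<not> turing_le b (c (\<not> i))"
    and dense: "\<And>b i j m. b \<in> B i \<Longrightarrow> \<exists>b'\<in>B j. b' \<noteq> b \<and> (\<forall>k<m. b' k = b k)"
    and ne: "B True \<noteq> {}"
  obtains z :: "nat \<Rightarrow> nat \<Rightarrow> bool" where "\<And>j. z j \<in> S"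
    "\<And>A. (\<And>i. turing_le (c i) A) \<Longrightarrow> (\<And>j. turing_le (z j) A) \<Longrightarrow> turing_le x A"
proof -
  let ?\<Psi> = "joint_rel (c False) (c True)"
  let ?col = "\<lambda>e. pfst e \<noteq> 0"
  have colour: "?col e = i" if b: "b \<in> B i" and full: "\<forall>k. ?\<Psi> e k (b k)" for b i e
  proof (rule ccontr)
    assume "?col e \<noteq> i"
    then have "(if pfst e = 0 then c False else c True) = c (\<not> i)" by (cases i) auto
    then show False using index_imp_turing_le[OF full] c(2)[OF b] by simp
  qed
  have index: "\<exists>e. ?col e = i \<and> (\<forall>k. ?\<Psi> e k (b k))" if "b \<in> B i" for b i
    using c(1)[OF that] by (intro turing_le_imp_index) (cases i; simp)
  obtain z :: "nat \<Rightarrow> nat \<Rightarrow> bool" and n where z: "\<forall>j. z (j + 3) = z j" "\<forall>j m. \<exists>i. \<exists>b\<in>B i. \<forall>k<m. z j k = b k"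
    and ex: "\<forall>j. n (j + 2) \<le> n (j + 3) \<and> (\<exists>e<n (j + 1). departs ?\<Psi> e (z j) (n (j + 3)))"
    and unique: "\<forall>j k e. n (j + 2) \<le> k \<longrightarrow> e < n (j + 1) \<longrightarrow> departs ?\<Psi> e (z j) k \<longrightarrow>
      k = n (j + 3) \<and> ?col e = x j"
    by (atomize_elim, rule coding_sequences[of ?\<Psi> B ?col x])
      (erule (1) joint_rel_deterministic, erule index, erule (1) colour, erule dense, rule ne)
  show ?thesis
  proof (rule that[of z])
    show "z j \<in> S" for j
    proof (rule closed)
      fix m show "\<exists>a\<in>S. \<forall>k<m. z j k = a k"
      proof -
        obtain i b where "b \<in> B i" "\<forall>k<m. z j k = b k" using z(2)[rule_format, of m j] by blast
        then show ?thesis using sub[of i] by blast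
      qed
    qed
    fix A assume A: "\<And>i. turing_le (c i) A" "\<And>j. turing_le (z j) A"
    show "turing_le x A"
      using A(1) A(1) A(2) z(1)[rule_format] ex[rule_format] unique[rule_format]
      by (rule turing_le_decode)
  qed
qed

text \<open>The real is coded by its rational cut, shifted by one place; bit 0 is left false so that
  the code is a point of level 0.\<close>

definition dedekind :: "real \<Rightarrow> nat \<Rightarrow> bool" where
  "dedekind r n \<longleftrightarrow> n \<noteq> 0 \<and> of_rat (from_nat (n - 1)) < r"

lemma level_dedekind: "level (dedekind r) = 0"
  by (simp add: level_def dedekind_def)

lemma inj_dedekind: "inj dedekind"
proof -
  have "dedekind r \<noteq> dedekind s" if less: "r < s" for r s
  proof -
    obtain q where q: "r < of_rat q" "of_rat q < s" using of_rat_dense[OF less] by blast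
    have "\<not> dedekind r (Suc (to_nat q))" "dedekind s (Suc (to_nat q))" using q by (simp_all add: dedekind_def)
    then show ?thesis by metis
  qed
  then show ?thesis by (metis injI linorder_neqE)
qed

lemma measurable_dedekind: "dedekind \<in> borel \<rightarrow>\<^sub>M cantor"
  unfolding cantor_def
proof (rule measurable_measure_of)
  fix X :: "(nat \<Rightarrow> bool) set" assume "X \<in> {{x. x n} |n. True}"
  then obtain n where "X = {x. x n}" by blast
  then have "dedekind -` X \<inter> space borel = (if n = 0 then {} else {of_rat (from_nat (n - 1))<..})"
    by (auto simp: dedekind_def)
  then show "dedekind -` X \<inter> space borel \<in> sets borel" by simp
qed auto

lemma no_borel_turing_embedding_ord3: "\<not> borel_turing_embedding UNIV ord3 f"
proof
  assume "borel_turing_embedding UNIV ord3 f"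
  then have "f \<in> restrict_space cantor UNIV \<rightarrow>\<^sub>M cantor"
    and emb: "\<And>x y. (x, y) \<in> ord3 \<longleftrightarrow> turing_le (f x) (f y)"
    by (simp_all add: borel_turing_embedding_def)
  then have f_meas: "f \<in> cantor \<rightarrow>\<^sub>M cantor"
    by (subst measurable_cong_sets[OF _ refl, of _ "restrict_space cantor UNIV"])
      (auto simp: sets_restrict_space)
  define F where "F r = f (dedekind r)" for r
  have inj_F: "r = s" if "F r = F s" for r s
  proof -
    \<comment> \<open>Reflexivity of reducibility makes points with equal images comparable, and
      comparable points of level 0 are equal.\<close>
    have "(dedekind r, dedekind s) \<in> ord3" using that turing_le_refl unfolding emb F_def by simp
    then have "dedekind r = dedekind s" using ord3_level[of "dedekind r" "dedekind s"] by (auto simp: level_dedekind)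
    then show ?thesis using inj_dedekind by (simp add: inj_eq)
  qed
  have meas: "{r. F r n} \<in> sets borel" for n
  proof -
    have "F \<in> borel \<rightarrow>\<^sub>M cantor" unfolding F_def using measurable_dedekind f_meas by (rule measurable_compose)
    from measurable_sets[OF this sets_cantor_bit[of n]] show ?thesis by (simp add: vimage_def)
  qed
  obtain K where K: "K \<subseteq> {0..1}" "uncountable K"
    "\<forall>z. (\<forall>m. \<exists>r\<in>K. \<forall>k<m. z k = F r k) \<longrightarrow> (\<exists>r\<in>K. F r = z)"
    by (rule borel_closed_image[of F, OF meas]) (rule that)
  have unc: "uncountable (F ` K)"
    using K(2) countable_image_inj_eq[of F K] inj_F by (auto simp: inj_on_def)
  obtain B :: "bool \<Rightarrow> (nat \<Rightarrow> bool) set" where B: "\<And>i. B i \<subseteq> F ` K" "\<And>i. countable (B i)"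
      "B False \<inter> B True = {}" "B True \<noteq> {}"
      "\<forall>i j m. \<forall>b\<in>B i. \<exists>b'\<in>B j. b' \<noteq> b \<and> (\<forall>k<m. b' k = b k)"
    by (rule uncountable_dense_pair[OF unc]) (rule that)
  \<comment> \<open>Density makes \<open>B False\<close> nonempty as well, so both sets can be
    enumerated with repetitions.\<close>
  have "B i \<noteq> {}" for i using B(4) B(5)[rule_format, of _ True i 0] by blast
  then have "\<exists>\<rho>. B i = range (\<lambda>k :: nat. F (\<rho> k)) \<and> range \<rho> \<subseteq> K" for i
  proof -
    obtain \<beta> :: "nat \<Rightarrow> nat \<Rightarrow> bool" where \<beta>: "B i = range \<beta>"
      using \<open>\<And>i. B i \<noteq> {}\<close> B(2) by (metis uncountable_def)
    then have "\<forall>k. \<exists>r\<in>K. \<beta> k = F r" using B(1)[of i] by blast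
    then obtain \<rho> where "\<forall>k. \<rho> k \<in> K \<and> \<beta> k = F (\<rho> k)" by metis
    then show ?thesis using \<beta> by (intro exI[of _ \<rho>]) auto
  qed
  then obtain \<rho> where \<rho>: "\<And>i. B i = range (\<lambda>k :: nat. F (\<rho> i k))" "\<And>i. range (\<rho> i) \<subseteq> K" by metis
  define M where "M i = node 1 (\<lambda>k. dedekind (\<rho> i k))" for i
  have below_M: "(dedekind r, M i) \<in> ord3 \<longleftrightarrow> r \<in> range (\<rho> i)" for r i
  proof -
    \<comment> \<open>No level lies strictly between 0 and the level 1 of
      \<open>M i\<close>.\<close>
    have "\<not> (\<exists>w. child (dedekind r) w \<and> child w (M i))"
    proof
      assume "\<exists>w. child (dedekind r) w \<and> child w (M i)"
      then obtain w where "child (dedekind r) w" "child w (M i)" by blast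
      from this[THEN child_level] show False by (simp add: M_def level_node)
    qed
    moreover have "dedekind r \<noteq> M i" using level_dedekind[of r] level_node[of 1] by (auto simp: M_def)
    moreover have "child (dedekind r) (M i) \<longleftrightarrow> r \<in> range (\<rho> i)"
      unfolding M_def using inj_dedekind by (subst child_node) (auto simp: level_dedekind inj_eq)
    ultimately show ?thesis unfolding ord3_iff by blast
  qed
  have below: "turing_le (F r) (f (M i)) \<longleftrightarrow> F r \<in> B i" for r i
    unfolding F_def emb[symmetric] below_M unfolding \<rho> using inj_F by (auto simp: F_def)
  \<comment> \<open>The real to be coded is \<open>F 2\<close>: as \<open>K\<close> lies in the unit
    interval, \<open>dedekind 2\<close> is none of the points used in the construction.\<close>
  obtain z :: "nat \<Rightarrow> nat \<Rightarrow> bool" where z: "\<And>j. z j \<in> F ` K"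
    and code: "\<And>A. (\<And>i. turing_le (f (M i)) A) \<Longrightarrow> (\<And>j. turing_le (z j) A) \<Longrightarrow> turing_le (F 2) A"
  proof (rule closed_set_codes_every_real[where S = "F ` K" and B = B and c = "\<lambda>i. f (M i)" and x = "F 2"])
    fix y assume "\<And>m. \<exists>a\<in>F ` K. \<forall>k<m. y k = a k"
    then have "\<forall>m. \<exists>r\<in>K. \<forall>k<m. y k = F r k" by blast
    then show "y \<in> F ` K" using K(3) by blast
  next
    fix i b assume b: "b \<in> B i"
    then obtain r where r: "b = F r" using B(1)[of i] by blast
    show "turing_le b (f (M i))" using b below[of r i] r by simp
    have "b \<notin> B (\<not> i)" using b B(3) by (cases i) auto
    then show "\<not> turing_le b (f (M (\<not> i)))" using below[of r "\<not> i"] r by simp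
  qed (use B in blast)+
  have "\<exists>r. r \<in> K \<and> z j = F r" for j using z[of j] by blast
  then obtain a where "\<forall>j. a j \<in> K \<and> z j = F (a j)" using choice[of "\<lambda>j r. r \<in> K \<and> z j = F r"] by blast
  then have a: "a j \<in> K" "z j = F (a j)" for j by simp_all
  \<comment> \<open>Lying above both \<open>M i\<close> and all preimages
    \<open>dedekind (a j)\<close> of the limits, \<open>t\<close> has an image that computes
    everything from which \<open>F 2\<close> is recovered.\<close>
  define t where "t = node 2 (\<lambda>k. if k = 0 then M False else if k = 1 then M True else dedekind (a (k - 2)))"
  have child_t: "child w t \<longleftrightarrow> (\<exists>i. w = M i) \<or> (\<exists>j. w = dedekind (a j))" for w
  proof -
    have "(\<exists>k. w = (if k = 0 then M False else if k = 1 then M True else dedekind (a (k - 2)))) \<longleftrightarrow>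
      (\<exists>i. w = M i) \<or> (\<exists>j. w = dedekind (a j))" (is "(\<exists>k. w = ?g k) \<longleftrightarrow> _")
    proof
      assume "\<exists>k. w = ?g k"
      then show "(\<exists>i. w = M i) \<or> (\<exists>j. w = dedekind (a j))" by (auto split: if_splits)
    next
      have "M i = ?g (if i then 1 else 0)" "dedekind (a j) = ?g (j + 2)" for i j by (cases i) auto
      then show "(\<exists>i. w = M i) \<or> (\<exists>j. w = dedekind (a j)) \<Longrightarrow> \<exists>k. w = ?g k" by blast
    qed
    moreover have "level (M i) < 2" "level (dedekind (a j)) < 2" for i j
      by (simp_all add: M_def level_node level_dedekind)
    ultimately show ?thesis unfolding t_def by (subst child_node) auto
  qed
  have "turing_le (F 2) (f t)"
  proof (rule code)
    show "turing_le (f (M i)) (f t)" for i unfolding emb[symmetric] ord3_iff child_t by blast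
    show "turing_le (z j) (f t)" for j unfolding a(2) F_def emb[symmetric] ord3_iff child_t by blast
  qed
  then have le: "(dedekind 2, t) \<in> ord3" by (simp add: F_def emb)
  have not_K: "2 \<notin> K" using K(1) by auto
  have "dedekind 2 \<noteq> t" using level_dedekind[of 2] level_node[of 2] by (auto simp: t_def)
  moreover have "(dedekind 2, M i) \<notin> ord3" for i using below_M[of 2 i] \<rho>(2)[of i] not_K by auto
  moreover have "dedekind 2 \<noteq> dedekind (a j)" for j using a(1)[of j] not_K inj_dedekind by (auto simp: inj_eq)
  moreover have "\<not> child (dedekind 2) (dedekind (a j))" for j by (simp add: child_def level_dedekind)
  ultimately show False using le unfolding ord3_iff[of "dedekind 2" t] child_t
    by (metis ord3_iff)
qed

theorem theorem1p7:
  shows "\<exists>P r. borel_partial_order P r \<and> locally_countable P r \<and> has_height P r 3 \<and>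
           \<not> (\<exists>f. borel_turing_embedding P r f)"
  using borel_partial_order_ord3 locally_countable_ord3 has_height_ord3 no_borel_turing_embedding_ord3
  by blast

end
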